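(* Let $I$ be a finite set with $\#I\ge2$ and suppose that for each $i\in I$ there is an invertible matrix $A_i\in\mathbb{R}^{d\times d}$. If $K\subset I^\infty$ is a nonempty compact set with $\sigma(K)\subset K$ and $t\ge0$, then there exists an ergodic $(K,t)$-equilibrium measure.
   Context: $I^\infty=I^{\mathbb{N}}$ carries the (compact, metrizable) product topology of the discrete set $I$, and $\sigma(i_1,i_2,\ldots)=(i_2,i_3,\ldots)$ is the left shift. For $\mathtt{i}\in I^\infty$, $\mathtt{i}|_n\in I^n$ is its initial word of length $n$; for $\mathtt{i}\in I^n$, $[\mathtt{i}]=\{\mathtt{j}\in I^\infty:\mathtt{j}|_n=\mathtt{i}\}$ is the cylinder and $A_{\mathtt{i}}=A_{i_1}\cdots A_{i_n}$. For $K\subset I^\infty$, $K_n=\{\mathtt{i}|_n:\mathtt{i}\in K\}$. $\alpha_1(A)\ge\cdots\ge\alpha_d(A)>0$ are the singular values of an invertible $A\in\mathbb{R}^{d\times d}$. The singular value function is $\varphi^t(A)=\alpha_1(A)\cdots\alpha_l(A)\,\alpha_{l+1}(A)^{t-l}$ for $0\le t<d$, $l=\lfloor t\rfloor$, and $\varphi^t(A)=|\det A|^{t/d}$ for $t\ge d$. For nonempty $K$ with $\sigma(K)\subset K$, the topological pressure is $P_K(t)=\lim_{n\to\infty}\frac1n\log\sum_{\mathtt{i}\in K_n}\varphi^t(A_{\mathtt{i}})$, $t\ge0$ (the limit exists by subadditivity). $\mathcal{M}_\sigma(K)$ is the set of $\sigma$-invariant Borel probability measures on $I^\infty$ whose support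 is contained in $K$; ergodic means ergodic with respect to $\sigma$. For $\mu\in\mathcal{M}_\sigma(K)$, with $H(x)=-x\log x$ for $0<x\le1$ and $H(0)=0$, the entropy is $h(\mu)=\lim_{n\to\infty}\frac1n\sum_{\mathtt{i}\in I^n}H(\mu([\mathtt{i}]))$ and the $t$-energy is $\Lambda^t(\mu)=\lim_{n\to\infty}\frac1n\sum_{\mathtt{i}\in I^n}\mu([\mathtt{i}])\log\varphi^t(A_{\mathtt{i}})$ (both limits exist). A measure $\mu\in\mathcal{M}_\sigma(K)$ is a $(K,t)$-equilibrium measure if $P_K(t)=h(\mu)+\Lambda^t(\mu)$. *)

theory Defs
  imports "HOL-Probability.Probability" "HOL-Computational_Algebra.Polynomial"
    "HOL-Library.Multiset"
begin

section \<open>Symbolic space\<close>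

text \<open>Infinite words over the alphabet \<open>I\<close> are functions \<open>nat \<Rightarrow> 'i\<close>, the letter
  $i_{n+1}$ being the value at \<open>n\<close>; finite words are lists.\<close>

definition seq_top :: "'i set \<Rightarrow> (nat \<Rightarrow> 'i) topology" where
  "seq_top I = product_topology (\<lambda>_. discrete_topology I) UNIV"

definition left_shift :: "(nat \<Rightarrow> 'i) \<Rightarrow> nat \<Rightarrow> 'i" where
  "left_shift x = (\<lambda>n. x (Suc n))"

definition init_word :: "nat \<Rightarrow> (nat \<Rightarrow> 'i) \<Rightarrow> 'i list" where
  "init_word n x = map x [0..<n]"

definition words :: "'i set \<Rightarrow> nat \<Rightarrow> 'i list set" where
  "words I n = {w. set w \<subseteq> I \<and> length w = n}"

definition cylinder :: "'i set \<Rightarrow> 'i list \<Rightarrow> (nat \<Rightarrow> 'i) set" where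
  "cylinder I w = {x \<in> topspace (seq_top I). init_word (length w) x = w}"

section \<open>Singular values and the singular value function\<close>

definition charpoly :: "real ^ 'n ^ 'n \<Rightarrow> real poly" where
  "charpoly M = det (mat [:0, 1:] - map_matrix (\<lambda>c. [:c:]) M)"

text \<open>The square roots of the eigenvalues of $A^T A$, repeated according to multiplicity and in
  non-increasing order. All complex eigenvalues of $A^T A$ are real, so the real roots counted
  by \<^const>\<open>proots\<close> are all of them.\<close>

definition singular_values :: "real ^ 'n ^ 'n \<Rightarrow> real list" where
  "singular_values M =
     rev (sorted_list_of_multiset (image_mset sqrt (proots (charpoly (transpose M ** M)))))"

text \<open>$\alpha_k$ is indexed from $k = 1$.\<close>

definition sing_val :: "nat \<Rightarrow> real ^ 'n ^ 'n \<Rightarrow> real" where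
  "sing_val k M = singular_values M ! (k - 1)"

definition svf :: "real \<Rightarrow> real ^ 'n ^ 'n \<Rightarrow> real" where
  "svf t M =
     (if t < real CARD('n)
      then let l = nat \<lfloor>t\<rfloor> in (\<Prod>k = 1..l. sing_val k M) * sing_val (l + 1) M powr (t - real l)
      else \<bar>det M\<bar> powr (t / real CARD('n)))"

definition word_mat :: "('i \<Rightarrow> real ^ 'n ^ 'n) \<Rightarrow> 'i list \<Rightarrow> real ^ 'n ^ 'n" where
  "word_mat A w = foldr (\<lambda>i M. A i ** M) w (mat 1)"

section \<open>Pressure, entropy, energy\<close>

definition pressure :: "('i \<Rightarrow> real ^ 'n ^ 'n) \<Rightarrow> (nat \<Rightarrow> 'i) set \<Rightarrow> real \<Rightarrow> real" where
  "pressure A K t = lim (\<lambda>n. 1 / real n * ln (\<Sum>w \<in> init_word n ` K. svf t (word_mat A w)))"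

definition entropy_fun :: "real \<Rightarrow> real" where
  "entropy_fun x = (if x = 0 then 0 else - x * ln x)"

definition measure_entropy :: "'i set \<Rightarrow> (nat \<Rightarrow> 'i) measure \<Rightarrow> real" where
  "measure_entropy I \<mu> =
     lim (\<lambda>n. 1 / real n * (\<Sum>w \<in> words I n. entropy_fun (measure \<mu> (cylinder I w))))"

definition energy ::
    "'i set \<Rightarrow> ('i \<Rightarrow> real ^ 'n ^ 'n) \<Rightarrow> real \<Rightarrow> (nat \<Rightarrow> 'i) measure \<Rightarrow> real" where
  "energy I A t \<mu> =
     lim (\<lambda>n. 1 / real n *
       (\<Sum>w \<in> words I n. measure \<mu> (cylinder I w) * ln (svf t (word_mat A w))))"

section \<open>Invariant, ergodic and equilibrium measures\<close>

definition seq_borel :: "'i set \<Rightarrow> (nat \<Rightarrow> 'i) measure" where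
  "seq_borel I = sigma (topspace (seq_top I)) {U. openin (seq_top I) U}"

definition measure_support :: "'i set \<Rightarrow> (nat \<Rightarrow> 'i) measure \<Rightarrow> (nat \<Rightarrow> 'i) set" where
  "measure_support I \<mu> =
     {x \<in> topspace (seq_top I). \<forall>U. openin (seq_top I) U \<and> x \<in> U \<longrightarrow> measure \<mu> U > 0}"

definition invariant_measures :: "'i set \<Rightarrow> (nat \<Rightarrow> 'i) set \<Rightarrow> (nat \<Rightarrow> 'i) measure set" where
  "invariant_measures I K =
     {\<mu>. prob_space \<mu> \<and> sets \<mu> = sets (seq_borel I) \<and>
         (\<forall>B \<in> sets \<mu>. measure \<mu> (left_shift -` B \<inter> space \<mu>) = measure \<mu> B) \<and>
         measure_support I \<mu> \<subseteq> K}"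

definition shift_ergodic :: "(nat \<Rightarrow> 'i) measure \<Rightarrow> bool" where
  "shift_ergodic \<mu> \<longleftrightarrow>
     (\<forall>B \<in> sets \<mu>. left_shift -` B \<inter> space \<mu> = B \<longrightarrow> measure \<mu> B = 0 \<or> measure \<mu> B = 1)"

definition equilibrium_measure ::
    "'i set \<Rightarrow> ('i \<Rightarrow> real ^ 'n ^ 'n) \<Rightarrow> (nat \<Rightarrow> 'i) set \<Rightarrow> real \<Rightarrow> (nat \<Rightarrow> 'i) measure \<Rightarrow> bool" where
  "equilibrium_measure I A K t \<mu> \<longleftrightarrow>
     \<mu> \<in> invariant_measures I K \<and> pressure A K t = measure_entropy I \<mu> + energy I A t \<mu>"

end

theory Submission
  imports Defs
begin

text \<open>The singular value function enters only through two properties: it is positive on invertible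
  matrices (\<open>svf_pos\<close>), and $\varphi^t(MN) \le 2^d\varphi^t(M)\varphi^t(N)$ (\<open>svf_mult_le\<close>). The constant
  $2^d$ disappears after taking logarithms and dividing by $n$, so exterior powers can be avoided:
  $\det(1 + s M^TM) = \prod_i (1 + s\alpha_i(M)^2)$ satisfies
  $\det(1 + su (MN)^TMN) \le \det(1 + sM^TM)\det(1 + uN^TN)$, and the infimum over \<open>s\<close> of
  $s^{-k}\det(1 + sM^TM)$ agrees with $(\alpha_1 \cdots \alpha_k)^2$ up to the factor $2^d$.

  From then on the matrices are replaced by an arbitrary positive weight on words, almost
  submultiplicative under concatenation. An invariant measure on \<open>K\<close> is represented by its cylinder
  masses, a function on words subject to closed linear conditions, so that the invariant measures form
  a compact convex subset \<open>masses\<close> of the product space of functions on words. Entropies of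
  blocks are subadditive and energies of blocks are almost subadditive, so Fekete's lemma yields
  both limits and bounds them from above by every finite-block average.

  Every Gibbs-type bound used here is one inequality: $\sum p\log g - \sum p\log p \le \log\sum g$ for a
  probability vector \<open>p\<close> (\<open>gibbs_inequality\<close>). With \<open>g\<close> the weight it gives
  $h + \Lambda \le P_K$. With \<open>g\<close> a product of marginals it gives subadditivity of entropy. With \<open>g\<close>
  a product over consecutive blocks of averaged block frequencies it replaces the convexity arguments in
  the usual proof of the variational principle: the empirical masses of the Gibbs distributions on
  words of length \<open>N\<close> nearly attain the pressure in every block average
  (\<open>empirical_inequality\<close>), and their cluster points as \<open>N\<close> grows attain it (\<open>maximisers_nonempty\<close>).

  Ergodicity comes from extremality. The masses that attain the pressure form a compact face of
  \<open>masses\<close>; a point of it that maximises a strictly convex continuous functional is extreme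
  (\<open>extreme_maximiser\<close>). Such masses are realised by a measure, as the image of Lebesgue measure on
  $[0,1)$ under a coding by nested intervals (\<open>cylinder_masses_extend\<close>). If an invariant set \<open>B\<close> had
  measure strictly between \<open>0\<close> and \<open>1\<close>, conditioning on \<open>B\<close> and on its complement would write the masses
  as a convex combination, so conditioning on \<open>B\<close> would change nothing and \<open>B\<close> would be independent of
  itself.\<close>

section \<open>Spectral theorem for real symmetric matrices\<close>

lemma inner_matrix_vector_transpose: "x \<bullet> (A *v y) = (transpose A *v x) \<bullet> y" for A :: "real^'n^'m"
  by (simp add: dot_lmul_matrix)

text \<open>The Rayleigh quotient \<open>x \<bullet> S x\<close> attains its maximum on the compact unit
  sphere of the invariant subspace, and its first variation there shows that a maximiser is an
  eigenvector.\<close>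

lemma symmetric_eigenvector_on_subspace:
  fixes S :: "real^'n^'n"
  assumes S: "transpose S = S" and V: "subspace V" "\<And>x. x \<in> V \<Longrightarrow> S *v x \<in> V" and nz: "V \<noteq> {0}"
  obtains x l where "x \<in> V" "norm x = 1" "S *v x = l *\<^sub>R x"
proof -
  define f where "f x = x \<bullet> (S *v x)" for x
  have cf: "continuous_on UNIV f"
    unfolding f_def by (intro continuous_intros linear_continuous_on matrix_vector_mul_bounded_linear)
  have ne: "sphere 0 1 \<inter> V \<noteq> {}"
  proof -
    obtain v where v: "v \<in> V" "v \<noteq> 0" using nz subspace_0[OF V(1)] by auto
    then have "(1 / norm v) *\<^sub>R v \<in> sphere 0 1 \<inter> V" using subspace_scale[OF V(1)] by auto
    then show ?thesis by blast
  qed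
  have "compact (sphere 0 1 \<inter> V)" by (intro compact_Int_closed closed_subspace V) auto
  from continuous_attains_sup[OF this ne continuous_on_subset[OF cf subset_UNIV]]
  obtain x where x: "x \<in> V" "norm x = 1" and mx: "\<And>y. y \<in> V \<Longrightarrow> norm y = 1 \<Longrightarrow> f y \<le> f x"
    by auto
  define l where "l = f x"
  have bd: "f y \<le> l * (y \<bullet> y)" if "y \<in> V" for y
  proof (cases "y = 0")
    case False
    have "f ((1 / norm y) *\<^sub>R y) \<le> l"
      unfolding l_def by (intro mx subspace_scale[OF V(1)] that) (use False in auto)
    moreover have "f ((1 / norm y) *\<^sub>R y) = f y / (norm y)\<^sup>2"
      by (simp add: f_def matrix_vector_mult_scaleR power2_eq_square)
    ultimately show ?thesis using False by (simp add: divide_simps dot_square_norm)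
  qed (simp add: f_def)
  define z where "z = S *v x - l *\<^sub>R x"
  have zV: "z \<in> V" unfolding z_def by (intro subspace_diff subspace_scale V x)
  define c where "c = l * (z \<bullet> z) - f z"
  have c0: "c \<ge> 0" using bd[OF zV] by (simp add: c_def)
  \<comment> \<open>First variation of the Rayleigh quotient at its maximiser, in the direction \<open>z\<close>.\<close>
  have var: "0 \<le> - 2 * e * (z \<bullet> z) + e\<^sup>2 * c" for e :: real
  proof -
    have sx: "S *v x = z + l *\<^sub>R x" by (simp add: z_def)
    have sym: "x \<bullet> (S *v z) = (S *v x) \<bullet> z" using inner_matrix_vector_transpose[of x S z] S by simp
    have xx: "x \<bullet> x = 1" using x by (simp add: dot_square_norm)
    have fx: "x \<bullet> z = 0" using xx by (simp add: z_def inner_diff_right l_def f_def)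
    have "x + e *\<^sub>R z \<in> V" by (intro subspace_add subspace_scale V x zV)
    from bd[OF this] have "f (x + e *\<^sub>R z) \<le> l * ((x + e *\<^sub>R z) \<bullet> (x + e *\<^sub>R z))" .
    also have "f (x + e *\<^sub>R z) = l + 2 * e * (z \<bullet> z) + e\<^sup>2 * f z"
      by (simp add: f_def matrix_vector_right_distrib matrix_vector_mult_scaleR inner_add_left inner_add_right
          sym sx fx xx inner_commute[of z x] power2_eq_square algebra_simps)
    also have "l * ((x + e *\<^sub>R z) \<bullet> (x + e *\<^sub>R z)) = l + e\<^sup>2 * (l * (z \<bullet> z))"
      by (simp add: inner_add_left inner_add_right fx xx inner_commute[of z x] power2_eq_square algebra_simps)
    finally show ?thesis by (simp add: c_def algebra_simps)
  qed
  have "z \<bullet> z = 0"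
  proof (rule ccontr)
    define a where "a = z \<bullet> z"
    assume "z \<bullet> z \<noteq> 0"
    then have a: "a > 0" by (simp add: a_def)
    have "0 \<le> - 2 * (a / (c+1)) * a + (a/(c+1))\<^sup>2 * c" using var[of "a/(c+1)"] by (simp add: a_def)
    also have "\<dots> = a\<^sup>2 / (c+1)\<^sup>2 * (- c - 2)"
    proof -
      have "- 2 * (a / k) * a + (a/k)\<^sup>2 * (k - 1) = a\<^sup>2 / k\<^sup>2 * (- (k - 1) - 2)" if "k > 0" for k
        using that by (simp add: field_simps power2_eq_square)
      from this[of "c + 1"] show ?thesis using c0 by simp
    qed
    also have "\<dots> < 0" using a c0 by (intro mult_pos_neg) auto
    finally show False by simp
  qed
  then have "S *v x = l *\<^sub>R x" by (simp add: z_def)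
  with x that show ?thesis by blast
qed

text \<open>Induction on the dimension: the vectors of the subspace orthogonal to one eigenvector form a
  smaller invariant subspace, by symmetry of \<open>S\<close>.\<close>

lemma symmetric_orthonormal_eigenvectors:
  fixes S :: "real^'n^'n"
  assumes S: "transpose S = S" and V: "subspace V" "\<And>x. x \<in> V \<Longrightarrow> S *v x \<in> V"
  shows "\<exists>B. finite B \<and> card B = dim V \<and> B \<subseteq> V \<and> (\<forall>b\<in>B. norm b = 1 \<and> (\<exists>l. S *v b = l *\<^sub>R b)) \<and>
    (\<forall>b\<in>B. \<forall>c\<in>B. b \<noteq> c \<longrightarrow> b \<bullet> c = 0)"
  using V
proof (induction "dim V" arbitrary: V)
  case 0
  then show ?case by (intro exI[of _ "{}"]) auto
next
  case (Suc k)
  have "V \<noteq> {0}" using Suc.hyps(2) by auto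
  then obtain x l where x: "x \<in> V" "norm x = 1" "S *v x = l *\<^sub>R x"
    using symmetric_eigenvector_on_subspace[OF S Suc.prems] by metis
  define W where "W = {y \<in> V. \<forall>v\<in>span {x}. orthogonal v y}"
  have W: "W = V \<inter> {y. x \<bullet> y = 0}"
    unfolding W_def by (auto simp: orthogonal_def span_singleton)
  have "dim W + dim (span {x}) = dim V"
    unfolding W_def by (rule dim_subspace_orthogonal_to_vectors) (use Suc.prems x span_minimal[of "{x}" V] in auto)
  moreover have "dim (span {x}) = 1" using x by (auto simp: dim_span dim_singleton)
  ultimately have dW: "k = dim W" using Suc.hyps(2) by simp
  have sW: "subspace W" unfolding W by (rule subspace_inter[OF Suc.prems(1) subspace_hyperplane])
  have iW: "S *v y \<in> W" if "y \<in> W" for y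
    using that Suc.prems(2) inner_matrix_vector_transpose[of x S y] S x(3) by (auto simp: W)
  obtain B where B: "finite B" "card B = dim W" "B \<subseteq> W" "\<forall>b\<in>B. norm b = 1 \<and> (\<exists>l. S *v b = l *\<^sub>R b)"
    "\<forall>b\<in>B. \<forall>c\<in>B. b \<noteq> c \<longrightarrow> b \<bullet> c = 0"
    using Suc.hyps(1)[OF dW sW iW] by blast
  have "x \<notin> B" using B(3) x(2) by (auto simp: W dot_square_norm)
  show ?case
    by (rule exI[of _ "insert x B"]) (use B x \<open>x \<notin> B\<close> dW Suc.hyps(2) W in \<open>auto simp: inner_commute\<close>)
qed

definition diag_matrix :: "('n \<Rightarrow> 'a::zero) \<Rightarrow> 'a^'n^'n" where
  "diag_matrix f = (\<chi> i j. if i = j then f i else 0)"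

lemma diag_matrix_nth [simp]: "diag_matrix f $ i $ j = (if i = j then f i else 0)"
  by (simp add: diag_matrix_def)

lemma transpose_diag_matrix [simp]: "transpose (diag_matrix f) = diag_matrix f"
  by (auto simp: vec_eq_iff transpose_def)

lemma det_diag_matrix [simp]: "det (diag_matrix f) = (\<Prod>i\<in>UNIV. f i)"
  by (subst det_diagonal) auto

lemma diag_matrix_mult: "diag_matrix f ** diag_matrix g = diag_matrix (\<lambda>i. f i * g i :: 'a::semiring_1)"
  by (simp add: vec_eq_iff matrix_matrix_mult_def mult_delta_left)

theorem symmetric_diagonalisation:
  fixes S :: "real^'n^'n"
  assumes S: "transpose S = S"
  obtains Q f where "orthogonal_matrix Q" "S = Q ** diag_matrix f ** transpose Q"
proof -
  obtain B where B: "finite B" "card B = CARD('n)"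
    "\<forall>b\<in>B. norm b = 1 \<and> (\<exists>l. S *v b = l *\<^sub>R b)"
    "\<forall>b\<in>B. \<forall>c\<in>B. b \<noteq> c \<longrightarrow> b \<bullet> c = 0"
    using symmetric_orthonormal_eigenvectors[OF S subspace_UNIV] by auto
  obtain e where e: "bij_betw e (UNIV :: 'n set) B"
    using finite_same_card_bij[OF finite_class.finite_UNIV B(1)] B(2) by auto
  then have eB: "e i \<in> B" for i by (auto simp: bij_betw_def)
  have "\<forall>i. \<exists>l. S *v e i = l *\<^sub>R e i" using B(3) eB by blast
  then obtain f where f: "\<And>i. S *v e i = f i *\<^sub>R e i"
    using choice[of "\<lambda>i l. S *v e i = l *\<^sub>R e i"] by blast
  define Q where "Q = (\<chi> i j. e j $ i)"
  have colQ: "column j Q = e j" for j by (simp add: Q_def column_def vec_eq_iff)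
  have ee: "e i \<bullet> e j = (if i = j then 1 else 0)" for i j
  proof (cases "i = j")
    case True
    then show ?thesis using B(3) eB[of j] by (simp add: dot_square_norm)
  next
    case False
    then have "e i \<noteq> e j" using e by (auto simp: bij_betw_def dest: injD)
    then show ?thesis using B(4) eB False by simp
  qed
  have oQ: "orthogonal_matrix Q"
    unfolding orthogonal_matrix_orthonormal_columns colQ orthogonal_def norm_eq_1
    by (simp add: ee)
  have "S ** Q = Q ** diag_matrix f"
  proof -
    have "(S ** Q) $ i $ j = (Q ** diag_matrix f) $ i $ j" for i j
    proof -
      have "(S ** Q) $ i $ j = (S *v e j) $ i"
        by (simp add: matrix_matrix_mult_def matrix_vector_mult_def Q_def)
      also have "\<dots> = (Q ** diag_matrix f) $ i $ j"
        by (simp add: f matrix_matrix_mult_def Q_def mult_delta_right)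
      finally show ?thesis .
    qed
    then show ?thesis by (simp add: vec_eq_iff)
  qed
  then have "S ** Q ** transpose Q = Q ** diag_matrix f ** transpose Q" by simp
  moreover have "Q ** transpose Q = mat 1" using oQ by (simp add: orthogonal_matrix_def)
  ultimately have "S = Q ** diag_matrix f ** transpose Q" by (simp flip: matrix_mul_assoc)
  with oQ that show ?thesis by blast
qed

section \<open>Positive semidefinite matrices and determinants\<close>

definition psd :: "real^'n^'n \<Rightarrow> bool" where
  "psd S \<longleftrightarrow> transpose S = S \<and> (\<forall>x. 0 \<le> x \<bullet> (S *v x))"

lemma psd_congruence: "psd S \<Longrightarrow> psd (transpose T ** S ** T)"
  by (simp add: psd_def matrix_transpose_mul matrix_mul_assoc matrix_vector_mul_assoc[symmetric]
      inner_matrix_vector_transpose[of _ "transpose T"] del: transpose_matrix_vector)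

lemma psd_mat_1: "psd (mat 1)" by (simp add: psd_def)

lemma psd_gram: "psd (transpose T ** T)"
  using psd_congruence[OF psd_mat_1, of T] by simp

lemma psd_scaleR: "psd S \<Longrightarrow> 0 \<le> c \<Longrightarrow> psd (c *\<^sub>R S)"
  by (simp add: psd_def transpose_scalar scaleR_matrix_vector_assoc[symmetric])

lemma psd_diagonalisation:
  assumes "psd S"
  obtains Q f where "orthogonal_matrix Q" "S = Q ** diag_matrix f ** transpose Q" "\<And>i. 0 \<le> f i"
proof -
  obtain Q f where Q: "orthogonal_matrix Q" "S = Q ** diag_matrix f ** transpose Q"
    using symmetric_diagonalisation assms unfolding psd_def by metis
  have "diag_matrix f = transpose Q ** S ** Q"
    using Q(1) by (simp add: Q(2) orthogonal_matrix_def matrix_mul_assoc)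
      (simp add: orthogonal_matrix_def flip: matrix_mul_assoc)
  then have "psd (diag_matrix f)" using psd_congruence[OF assms] by simp
  then have "0 \<le> axis i 1 \<bullet> (diag_matrix f *v axis i 1)" for i by (simp add: psd_def)
  then have "0 \<le> f i" for i
    by (simp add: inner_axis' matrix_vector_mult_basis column_def)
  with Q that show ?thesis by blast
qed

lemma matrix_add_rdistrib: "(A + B) ** C = A ** C + (B ** C :: 'a::semiring_1^'k^'m)"
  by (simp add: vec_eq_iff matrix_matrix_mult_def sum.distrib distrib_right)

lemma scaleR_matrix_mult: "(c *\<^sub>R A) ** B = c *\<^sub>R (A ** B)" "A ** (c *\<^sub>R B) = c *\<^sub>R (A ** B)"
  for A :: "real^'n^'m" and B :: "real^'k^'n"
  by (simp_all add: vec_eq_iff matrix_matrix_mult_def sum_distrib_left algebra_simps)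

lemma diag_matrix_shift: "mat 1 + s *\<^sub>R diag_matrix f = diag_matrix (\<lambda>i. 1 + s * f i :: real)"
  by (simp add: vec_eq_iff mat_def)

lemma det_orthogonal_conj:
  fixes Q :: "real^'n^'n"
  assumes "orthogonal_matrix Q"
  shows "det (Q ** M ** transpose Q) = det M"
proof -
  have "det Q * det (transpose Q) = 1"
    using assms by (metis det_I det_mul orthogonal_matrix_def)
  then show ?thesis by (simp add: det_mul)
qed

lemma det_mat_1_plus_diagonalised:
  assumes "orthogonal_matrix Q"
  shows "det (mat 1 + s *\<^sub>R (Q ** diag_matrix f ** transpose Q)) = (\<Prod>i\<in>UNIV. 1 + s * f i)"
proof -
  have "mat 1 + s *\<^sub>R (Q ** diag_matrix f ** transpose Q) = Q ** (mat 1 + s *\<^sub>R diag_matrix f) ** transpose Q"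
    using assms by (simp add: matrix_add_ldistrib matrix_add_rdistrib scaleR_matrix_mult orthogonal_matrix_def)
  then show ?thesis by (simp add: det_orthogonal_conj[OF assms] diag_matrix_shift)
qed

lemma psd_det_mat_1_plus_ge_1:
  assumes "psd N" shows "1 \<le> det (mat 1 + N)"
proof -
  obtain Q f where Q: "orthogonal_matrix Q" "N = Q ** diag_matrix f ** transpose Q" "\<And>i. 0 \<le> f i"
    using psd_diagonalisation[OF assms] by blast
  show ?thesis
    using det_mat_1_plus_diagonalised[OF Q(1), of 1 f] Q(3)
    by (simp flip: Q(2)) (simp add: prod_ge_1)
qed

lemma mat_1_plus_psd_sqrt:
  assumes "psd N"
  obtains R where "transpose R = R" "R ** R = mat 1 + N" "invertible R"
proof -
  obtain Q f where Q: "orthogonal_matrix Q" "N = Q ** diag_matrix f ** transpose Q" "\<And>i. 0 \<le> f i"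
    using psd_diagonalisation[OF assms] by blast
  define R where "R = Q ** diag_matrix (\<lambda>i. sqrt (1 + f i)) ** transpose Q"
  have tQ: "transpose Q ** (Q ** X) = X" "Q ** transpose Q = mat 1" for X
    using Q(1) by (simp_all add: matrix_mul_assoc orthogonal_matrix_def)
  have f: "sqrt (1 + f i) * sqrt (1 + f i) = 1 + f i" for i
    using Q(3)[of i] by simp
  have "R ** R = Q ** (diag_matrix (\<lambda>i. sqrt (1 + f i)) ** diag_matrix (\<lambda>i. sqrt (1 + f i))) ** transpose Q"
    unfolding R_def by (simp add: tQ(1) flip: matrix_mul_assoc)
  also have "\<dots> = Q ** (mat 1 + 1 *\<^sub>R diag_matrix f) ** transpose Q"
    by (simp only: diag_matrix_mult f diag_matrix_shift mult_1)
  also have "\<dots> = mat 1 + N"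
    by (simp add: Q(2) matrix_add_ldistrib matrix_add_rdistrib tQ(2))
  finally have RR: "R ** R = mat 1 + N" .
  moreover have "transpose R = R" by (simp add: R_def matrix_transpose_mul matrix_mul_assoc)
  moreover have "det R * det R > 0"
    using psd_det_mat_1_plus_ge_1[OF assms] by (simp flip: det_mul add: RR)
  then have "invertible R" by (auto simp: invertible_det_nz)
  ultimately show ?thesis using that by blast
qed

text \<open>Monotonicity of the determinant. With \<open>R\<close> the square root of \<open>1 + P\<close> and
  \<open>T\<close> its inverse, \<open>1 + P + N = R (1 + T\<^sup>t N T) R\<close>, and the middle factor has
  determinant at least \<open>1\<close> because its eigenvalues are.\<close>

lemma psd_det_mono:
  assumes "psd P" "psd N" shows "det (mat 1 + P) \<le> det (mat 1 + P + N)"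
proof -
  obtain R where R: "transpose R = R" "R ** R = mat 1 + P" "invertible R"
    using mat_1_plus_psd_sqrt[OF assms(1)] .
  obtain T where T: "R ** T = mat 1" "T ** R = mat 1" using R(3) unfolding invertible_def by blast
  have "transpose (R ** T) = mat 1" by (simp add: T)
  then have tT: "transpose T ** R = mat 1" by (simp add: matrix_transpose_mul R)
  then have tT': "R ** transpose T = mat 1" using matrix_left_right_inverse by blast
  have "R ** (mat 1 + transpose T ** N ** T) ** R = mat 1 + P + (R ** transpose T) ** N ** (T ** R)"
    by (simp add: matrix_add_ldistrib matrix_add_rdistrib matrix_mul_assoc R)
  then have "mat 1 + P + N = R ** (mat 1 + transpose T ** N ** T) ** R" by (simp add: T tT')
  then have "det (mat 1 + P + N) = det (R ** R) * det (mat 1 + transpose T ** N ** T)"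
    by (simp add: det_mul)
  moreover have "1 \<le> det (mat 1 + transpose T ** N ** T)"
    by (intro psd_det_mat_1_plus_ge_1 psd_congruence assms)
  moreover have "1 \<le> det (R ** R)" unfolding R by (intro psd_det_mat_1_plus_ge_1 assms)
  ultimately show ?thesis by (simp add: R)
qed

text \<open>The product of \<open>1 + s \<alpha>\<^sup>2\<close> over all singular values
  \<open>\<alpha>\<close> of \<open>M\<close>. As a function of \<open>s\<close> it records all of them, and
  as a determinant it is accessible without the spectral decomposition of a product.\<close>

definition gram_det :: "real \<Rightarrow> real^'n^'n \<Rightarrow> real" where
  "gram_det s M = det (mat 1 + s *\<^sub>R (transpose M ** M))"

lemma gram_det_transpose:
  assumes "invertible M" shows "gram_det s (transpose M) = gram_det s M"
proof -
  have "M ** (mat 1 + s *\<^sub>R (transpose M ** M)) = (mat 1 + s *\<^sub>R (M ** transpose M)) ** M"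
    by (simp add: matrix_add_ldistrib matrix_add_rdistrib scaleR_matrix_mult matrix_mul_assoc)
  then have "det M * gram_det s M = gram_det s (transpose M) * det M"
    unfolding gram_det_def by (metis det_mul transpose_transpose)
  then show ?thesis using assms by (simp add: invertible_det_nz)
qed

text \<open>Write \<open>X = 1 + s M\<^sup>t M = R\<^sup>2\<close>. Adding the positive semidefinite \<open>u
  N\<^sup>t N\<close> turns the matrix on the left into \<open>1 + u (R N)\<^sup>t (R N)\<close>, which has
  the same determinant as \<open>1 + u (R N) (R N)\<^sup>t\<close>. Adding \<open>X - 1\<close> to the latter
  gives \<open>R (1 + u N N\<^sup>t) R\<close>, whose determinant is the right hand side. Both additions
  increase the determinant.\<close>

lemma gram_det_mult_le:
  assumes s: "s \<ge> 0" and u: "u \<ge> 0" and N: "invertible N"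
  shows "gram_det (s * u) (M ** N) \<le> gram_det s M * gram_det u N"
proof -
  define P where "P = s *\<^sub>R (transpose M ** M)"
  have P: "psd P" unfolding P_def by (intro psd_scaleR psd_gram s)
  obtain R where R: "transpose R = R" "R ** R = mat 1 + P" "invertible R"
    using mat_1_plus_psd_sqrt[OF P] .
  have psd1: "psd (u *\<^sub>R (transpose N ** P ** N))" "psd (u *\<^sub>R (transpose N ** N))"
    by (intro psd_scaleR psd_gram psd_congruence P u)+
  have "gram_det (s * u) (M ** N) = det (mat 1 + u *\<^sub>R (transpose N ** P ** N))"
    by (simp add: gram_det_def P_def matrix_transpose_mul matrix_mul_assoc scaleR_matrix_mult mult.commute)
  also have "\<dots> \<le> det (mat 1 + u *\<^sub>R (transpose N ** P ** N) + u *\<^sub>R (transpose N ** N))"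
    by (intro psd_det_mono psd1)
  also have "mat 1 + u *\<^sub>R (transpose N ** P ** N) + u *\<^sub>R (transpose N ** N)
      = mat 1 + u *\<^sub>R (transpose N ** (mat 1 + P) ** N)"
    by (simp add: matrix_add_ldistrib matrix_add_rdistrib scaleR_add_right)
  also have "det \<dots> = gram_det u (R ** N)"
    by (simp add: gram_det_def matrix_transpose_mul R(1) matrix_mul_assoc flip: R(2))
  also have "\<dots> = gram_det u (transpose (R ** N))"
    using gram_det_transpose[OF invertible_mult[OF R(3) N], of u] by simp
  also have "\<dots> = det (mat 1 + u *\<^sub>R (R ** (N ** transpose N) ** R))"
    by (simp add: gram_det_def matrix_transpose_mul R(1) matrix_mul_assoc)
  also have "\<dots> \<le> det (mat 1 + u *\<^sub>R (R ** (N ** transpose N) ** R) + P)"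
  proof (intro psd_det_mono psd_scaleR u P)
    show "psd (R ** (N ** transpose N) ** R)"
      using psd_congruence[OF psd_gram[of "transpose N"], of R] by (simp add: R(1))
  qed
  also have "mat 1 + u *\<^sub>R (R ** (N ** transpose N) ** R) + P = R ** (mat 1 + u *\<^sub>R (N ** transpose N)) ** R"
    by (simp add: matrix_add_ldistrib matrix_add_rdistrib scaleR_matrix_mult R(2))
  also have "det \<dots> = det (R ** R) * gram_det u (transpose N)"
    by (simp add: det_mul gram_det_def)
  also have "\<dots> = gram_det s M * gram_det u N"
    by (simp add: R(2) P_def gram_det_def[of s M] gram_det_transpose[OF N])
  finally show ?thesis .
qed

section \<open>Singular values and the singular value function\<close>

lemma const_poly_sum: "[:\<Sum>k\<in>S. f k:] = (\<Sum>k\<in>S. [:f k:])"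
  by (rule poly_eqI) (simp add: coeff_sum coeff_pCons split: nat.split)

lemma map_matrix_const_poly_mult:
  "map_matrix (\<lambda>c. [:c:]) (A ** B) = map_matrix (\<lambda>c. [:c::real:]) A ** map_matrix (\<lambda>c. [:c:]) B"
  by (simp add: vec_eq_iff matrix_matrix_mult_def const_poly_sum mult.commute)

lemma mat_commute: "mat c ** A = A ** mat (c :: 'a::comm_semiring_1)"
  by (simp add: vec_eq_iff matrix_matrix_mult_def mat_def mult_delta_left mult_delta_right mult.commute)

text \<open>The conjugation by \<open>Q\<close> is carried out over the polynomial ring, where the
  determinants of \<open>Q\<close> and of its transpose still cancel.\<close>

lemma charpoly_diagonalised:
  assumes Q: "orthogonal_matrix Q"
  shows "charpoly (Q ** diag_matrix f ** transpose Q) = (\<Prod>i\<in>UNIV. [:- f i, 1:])"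
proof -
  let ?C = "map_matrix (\<lambda>c::real. [:c:])"
  have one: "?C (mat 1) = mat 1" by (simp add: vec_eq_iff mat_def one_pCons)
  have QQ: "?C Q ** ?C (transpose Q) = mat 1"
    using Q one by (simp add: orthogonal_matrix_def flip: map_matrix_const_poly_mult)
  define X where "X = (mat [:0, 1:] :: real poly^'a^'a)"
  have "X - ?C (Q ** diag_matrix f ** transpose Q)
      = ?C Q ** (X - ?C (diag_matrix f)) ** ?C (transpose Q)"
  proof -
    have *: "?C Q ** (X - ?C (diag_matrix f)) ** ?C (transpose Q) + ?C Q ** ?C (diag_matrix f) ** ?C (transpose Q)
       = ?C Q ** X ** ?C (transpose Q)"
      by (simp flip: matrix_add_ldistrib matrix_add_rdistrib)
    have "?C Q ** X ** ?C (transpose Q) = X ** (?C Q ** ?C (transpose Q))"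
      unfolding X_def by (simp add: mat_commute matrix_mul_assoc)
    then show ?thesis using * by (simp add: map_matrix_const_poly_mult QQ algebra_simps)
  qed
  also have "X - ?C (diag_matrix f) = diag_matrix (\<lambda>i. [:- f i, 1:])"
    by (simp add: X_def vec_eq_iff mat_def)
  finally have "charpoly (Q ** diag_matrix f ** transpose Q)
      = det (?C Q) * (\<Prod>i\<in>UNIV. [:- f i, 1:]) * det (?C (transpose Q))"
    by (simp add: charpoly_def X_def det_mul)
  moreover have "det (?C Q) * det (?C (transpose Q)) = 1"
    by (metis QQ det_mul det_I)
  ultimately show ?thesis
    using mult.commute[of "\<Prod>i\<in>UNIV. [:- f i, 1:]"] by (simp add: mult.assoc)
qed

lemma singular_values_properties:
  fixes M :: "real^'n^'n"
  assumes M: "invertible M"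
  shows "length (singular_values M) = CARD('n)"
    and "\<And>k. k < CARD('n) \<Longrightarrow> 0 < singular_values M ! k"
    and "\<And>i j. i \<le> j \<Longrightarrow> j < CARD('n) \<Longrightarrow> singular_values M ! j \<le> singular_values M ! i"
    and "\<And>s. gram_det s M = (\<Prod>k<CARD('n). 1 + s * (singular_values M ! k)\<^sup>2)"
proof -
  obtain Q f where Q: "orthogonal_matrix Q" "transpose M ** M = Q ** diag_matrix f ** transpose Q" "\<And>i. 0 \<le> f i"
    using psd_diagonalisation[OF psd_gram] by blast
  have "det (transpose M ** M) = (\<Prod>i\<in>UNIV. f i)"
    unfolding Q(2) by (simp add: det_orthogonal_conj[OF Q(1)])
  moreover have "det (transpose M ** M) \<noteq> 0" using M by (simp add: det_mul invertible_det_nz)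
  ultimately have pos: "0 < f i" for i
    using Q(3)[of i] by (auto simp: less_le)
  have "proots (charpoly (transpose M ** M)) = (\<Sum>i\<in>UNIV. {#f i#})"
    unfolding Q(2) charpoly_diagonalised[OF Q(1)] by (subst proots_prod) auto
  also have "\<dots> = image_mset f (mset_set UNIV)"
    by (simp add: sum_unfold_sum_mset)
  finally have ms: "mset (singular_values M) = image_mset (\<lambda>i. sqrt (f i)) (mset_set UNIV)"
    by (simp add: singular_values_def image_mset.compositionality comp_def)
  show len: "length (singular_values M) = CARD('n)"
    using arg_cong[OF ms, of size] by simp
  have "set (singular_values M) = (\<lambda>i. sqrt (f i)) ` UNIV"
    using arg_cong[OF ms, of set_mset] by simp
  then have "x > 0" if "x \<in> set (singular_values M)" for x using that pos by auto
  then show "\<And>k. k < CARD('n) \<Longrightarrow> 0 < singular_values M ! k" by (simp add: len)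
  have "sorted (rev (singular_values M))" by (simp add: singular_values_def)
  then show "\<And>i j. i \<le> j \<Longrightarrow> j < CARD('n) \<Longrightarrow> singular_values M ! j \<le> singular_values M ! i"
    by (simp add: sorted_rev_nth_mono len)
  fix s
  have "gram_det s M = (\<Prod>i\<in>UNIV. 1 + s * f i)"
    unfolding gram_det_def Q(2) by (rule det_mat_1_plus_diagonalised[OF Q(1)])
  also have "\<dots> = (\<Prod>i\<in>UNIV. 1 + s * (sqrt (f i))\<^sup>2)" using Q(3) by simp
  also have "\<dots> = prod_mset (image_mset (\<lambda>x. 1 + s * x\<^sup>2) (mset (singular_values M)))"
    by (simp add: ms prod_unfold_prod_mset comp_def image_mset.compositionality)
  also have "\<dots> = prod_list (map (\<lambda>x. 1 + s * x\<^sup>2) (singular_values M))"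
    by (simp flip: prod_mset_prod_list)
  also have "\<dots> = (\<Prod>k<CARD('n). 1 + s * (singular_values M ! k)\<^sup>2)"
    by (simp add: prod.list_conv_set_nth len atLeast0LessThan)
  finally show "gram_det s M = (\<Prod>k<CARD('n). 1 + s * (singular_values M ! k)\<^sup>2)" .
qed

definition sv_prod :: "nat \<Rightarrow> real^'n^'n \<Rightarrow> real" where
  "sv_prod k M = (\<Prod>i<k. singular_values M ! i)"

lemma sv_prod_pos: "invertible M \<Longrightarrow> k \<le> CARD('n) \<Longrightarrow> 0 < sv_prod k M" for M :: "real^'n^'n"
  unfolding sv_prod_def by (intro prod_pos) (auto intro: singular_values_properties(2))

text \<open>This lemma and the next bracket the squared product of the \<open>k\<close> largest singular
  values: it is the infimum over \<open>s > 0\<close> of \<open>gram_det s M / s ^ k\<close> up to the factor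
  \<open>2 ^ CARD('n)\<close>. Here all but the first \<open>k\<close> factors are bounded below by
  \<open>1\<close>, and the others by dropping the summand \<open>1\<close>.\<close>

lemma sv_prod_le_gram_det:
  fixes M :: "real^'n^'n"
  assumes M: "invertible M" and k: "k \<le> CARD('n)" and s: "s \<ge> 0"
  shows "s ^ k * (sv_prod k M)\<^sup>2 \<le> gram_det s M"
proof -
  let ?g = "\<lambda>i. 1 + s * (singular_values M ! i)\<^sup>2"
  have "s ^ k * (sv_prod k M)\<^sup>2 = (\<Prod>i<k. s * (singular_values M ! i)\<^sup>2)"
    by (simp add: sv_prod_def prod.distrib prod_power_distrib)
  also have "\<dots> \<le> (\<Prod>i<k. ?g i)" using s by (intro prod_mono) auto
  also have "\<dots> \<le> (\<Prod>i<CARD('n). ?g i)"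
    by (rule prod_mono2) (use k s in auto)
  finally show ?thesis by (simp add: singular_values_properties(4)[OF M])
qed

text \<open>At the scale \<open>s\<close> where the \<open>k\<close>-th singular value becomes
  \<open>1\<close>, the larger term of \<open>1 + s \<alpha>\<^sup>2\<close> is \<open>s
  \<alpha>\<^sup>2\<close> for the first \<open>k\<close> values and \<open>1\<close> for the remaining ones,
  so each factor is at most twice that term.\<close>

lemma gram_det_le_sv_prod:
  fixes M :: "real^'n^'n"
  assumes M: "invertible M" and k: "k \<le> CARD('n)"
  obtains s where "s > 0" "gram_det s M \<le> 2 ^ CARD('n) * (s ^ k * (sv_prod k M)\<^sup>2)"
proof -
  define a where "a i = singular_values M ! i" for i
  \<comment> \<open>For \<open>k = 0\<close> truncated subtraction selects the largest singular value, and all factors are at most \<open>2\<close>.\<close>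
  define s where "s = 1 / (a (k - 1))\<^sup>2"
  have apos: "a i > 0" if "i < CARD('n)" for i unfolding a_def by (rule singular_values_properties(2)[OF M that])
  have k1: "k - 1 < CARD('n)" using k by (cases k) auto
  have s: "s > 0" using apos[OF k1] by (simp add: s_def)
  have *: "1 + s * (a i)\<^sup>2 \<le> 2 * (if i < k then s * (a i)\<^sup>2 else 1)" if i: "i < CARD('n)" for i
  proof (cases "i < k")
    case True
    then have "a (k - 1) \<le> a i" unfolding a_def by (intro singular_values_properties(3)[OF M]) (use k1 in auto)
    then have "(a (k - 1))\<^sup>2 \<le> (a i)\<^sup>2" using apos[OF k1] by (intro power_mono) auto
    then have "1 \<le> s * (a i)\<^sup>2" using apos[OF k1] by (simp add: s_def field_simps)
    with True show ?thesis by simp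
  next
    case False
    then have "a i \<le> a (k - 1)" unfolding a_def by (intro singular_values_properties(3)[OF M]) (use i in auto)
    then have "(a i)\<^sup>2 \<le> (a (k - 1))\<^sup>2" using apos[OF i] by (intro power_mono) auto
    then have "s * (a i)\<^sup>2 \<le> 1" using apos[OF k1] by (simp add: s_def field_simps)
    with False show ?thesis by simp
  qed
  have "gram_det s M = (\<Prod>i<CARD('n). 1 + s * (a i)\<^sup>2)"
    by (simp add: singular_values_properties(4)[OF M] a_def)
  also have "\<dots> \<le> (\<Prod>i<CARD('n). 2 * (if i < k then s * (a i)\<^sup>2 else 1))"
    using * s by (intro prod_mono) auto
  also have "\<dots> = 2 ^ CARD('n) * (\<Prod>i<CARD('n). if i < k then s * (a i)\<^sup>2 else 1)"
    by (simp add: prod.distrib)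
  also have "(\<Prod>i<CARD('n). if i < k then s * (a i)\<^sup>2 else 1) = (\<Prod>i<k. s * (a i)\<^sup>2)"
    by (rule prod.mono_neutral_cong_right) (use k in auto)
  also have "\<dots> = s ^ k * (sv_prod k M)\<^sup>2"
    by (simp add: sv_prod_def a_def prod.distrib prod_power_distrib)
  finally show ?thesis using s that by blast
qed

lemma sv_prod_mult_le:
  fixes M N :: "real^'n^'n"
  assumes M: "invertible M" and N: "invertible N" and k: "k \<le> CARD('n)"
  shows "sv_prod k (M ** N) \<le> 2 ^ CARD('n) * (sv_prod k M * sv_prod k N)"
proof -
  obtain s where s: "s > 0" "gram_det s M \<le> 2 ^ CARD('n) * (s ^ k * (sv_prod k M)\<^sup>2)"
    using gram_det_le_sv_prod[OF M k] .
  obtain u where u: "u > 0" "gram_det u N \<le> 2 ^ CARD('n) * (u ^ k * (sv_prod k N)\<^sup>2)"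
    using gram_det_le_sv_prod[OF N k] .
  have g0: "0 \<le> gram_det u N"
    using u(1) by (simp add: singular_values_properties(4)[OF N] prod_nonneg)
  have "(s * u) ^ k * (sv_prod k (M ** N))\<^sup>2 \<le> gram_det (s * u) (M ** N)"
    by (intro sv_prod_le_gram_det invertible_mult M N k) (use s u in auto)
  also have "\<dots> \<le> gram_det s M * gram_det u N" by (intro gram_det_mult_le N) (use s u in auto)
  also have "\<dots> \<le> (2 ^ CARD('n) * (s ^ k * (sv_prod k M)\<^sup>2)) * (2 ^ CARD('n) * (u ^ k * (sv_prod k N)\<^sup>2))"
    using s u g0 by (intro mult_mono) auto
  also have "\<dots> = (s * u) ^ k * (2 ^ CARD('n) * (sv_prod k M * sv_prod k N))\<^sup>2"
    by (simp add: power_mult_distrib power2_eq_square)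
  finally have "(sv_prod k (M ** N))\<^sup>2 \<le> (2 ^ CARD('n) * (sv_prod k M * sv_prod k N))\<^sup>2"
    using s(1) u(1) by simp
  then show ?thesis
    by (rule power2_le_imp_le) (use sv_prod_pos[OF M k] sv_prod_pos[OF N k] in auto)
qed

text \<open>A geometric mean of two products of largest singular values with nonnegative exponents, so upper
  bounds for such products carry over to \<open>svf\<close>.\<close>

lemma svf_eq_interpolation:
  fixes M :: "real^'n^'n"
  assumes M: "invertible M" and t: "0 \<le> t" "t < real CARD('n)"
  defines "l \<equiv> nat \<lfloor>t\<rfloor>"
  shows "svf t M = sv_prod l M powr (1 - (t - l)) * sv_prod (Suc l) M powr (t - l)"
proof -
  have l: "l < CARD('n)" unfolding l_def using t by linarith
  have p: "0 < sv_prod l M" by (rule sv_prod_pos[OF M]) (use l in auto)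
  have a: "0 < singular_values M ! l" by (rule singular_values_properties(2)[OF M l])
  have "(\<Prod>k = 1..l. sing_val k M) = sv_prod l M"
    unfolding sv_prod_def sing_val_def by (rule prod.reindex_bij_witness[of _ Suc "\<lambda>k. k - 1"]) auto
  then have "svf t M = sv_prod l M * (singular_values M ! l) powr (t - l)"
    using t by (simp add: svf_def l_def Let_def sing_val_def)
  also have "\<dots> = sv_prod l M powr (1 - (t - l)) * (sv_prod l M * singular_values M ! l) powr (t - l)"
    using p a by (simp add: powr_mult powr_diff)
  also have "sv_prod l M * singular_values M ! l = sv_prod (Suc l) M" by (simp add: sv_prod_def)
  finally show ?thesis .
qed

theorem svf_pos:
  fixes M :: "real^'n^'n"
  assumes M: "invertible M" and t: "0 \<le> t"
  shows "0 < svf t M"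
proof (cases "t < real CARD('n)")
  case True
  have "nat \<lfloor>t\<rfloor> < CARD('n)" using t True by linarith
  then show ?thesis
    unfolding svf_eq_interpolation[OF M t True]
    using sv_prod_pos[OF M, of "nat \<lfloor>t\<rfloor>"] sv_prod_pos[OF M, of "Suc (nat \<lfloor>t\<rfloor>)"]
    by simp
next
  case False
  then show ?thesis using M by (simp add: svf_def invertible_det_nz)
qed

theorem svf_mult_le:
  fixes M N :: "real^'n^'n"
  assumes M: "invertible M" and N: "invertible N" and t: "0 \<le> t"
  shows "svf t (M ** N) \<le> 2 ^ CARD('n) * (svf t M * svf t N)"
proof (cases "t < real CARD('n)")
  case True
  define l where "l = nat \<lfloor>t\<rfloor>"
  define C :: real where "C = 2 ^ CARD('n)"
  have l: "l < CARD('n)" "0 \<le> t - l" "t - l \<le> 1" unfolding l_def using t True by linarith+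
  have pos: "0 < sv_prod k M" "0 < sv_prod k N" "0 < sv_prod k (M ** N)" if "k \<le> CARD('n)" for k
    using that by (auto intro!: sv_prod_pos M N invertible_mult)
  have C: "C > 0" by (simp add: C_def)
  have le: "sv_prod k (M ** N) powr e \<le> C powr e * (sv_prod k M powr e * sv_prod k N powr e)"
    if "k \<le> CARD('n)" "e \<ge> 0" for k e
  proof -
    have "sv_prod k (M ** N) powr e \<le> (C * (sv_prod k M * sv_prod k N)) powr e"
      unfolding C_def
      using that pos(3) by (intro powr_mono2 sv_prod_mult_le M N) (auto intro: less_imp_le)
    then show ?thesis using pos[OF that(1)] C by (simp add: powr_mult)
  qed
  have "svf t (M ** N) = sv_prod l (M ** N) powr (1 - (t - l)) * sv_prod (Suc l) (M ** N) powr (t - l)"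
    unfolding l_def by (rule svf_eq_interpolation[OF invertible_mult[OF M N] t True])
  also have "\<dots> \<le> (C powr (1 - (t - l)) * (sv_prod l M powr (1 - (t - l)) * sv_prod l N powr (1 - (t - l)))) *
     (C powr (t - l) * (sv_prod (Suc l) M powr (t - l) * sv_prod (Suc l) N powr (t - l)))"
    using l by (intro mult_mono le) auto
  also have "\<dots> = (C powr (1 - (t - l)) * C powr (t - l)) *
     ((sv_prod l M powr (1 - (t - l)) * sv_prod (Suc l) M powr (t - l)) *
      (sv_prod l N powr (1 - (t - l)) * sv_prod (Suc l) N powr (t - l)))"
    by (simp only: mult_ac)
  also have "C powr (1 - (t - l)) * C powr (t - l) = C" using C by (simp flip: powr_add)
  finally show ?thesis
    unfolding C_def l_def svf_eq_interpolation[OF M t True] svf_eq_interpolation[OF N t True] .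
next
  case False
  then have "svf t (M ** N) = svf t M * svf t N"
    by (simp add: svf_def det_mul abs_mult powr_mult)
  also have "\<dots> \<le> 2 ^ CARD('n) * (svf t M * svf t N)"
    using mult_right_mono[of 1 "2 ^ CARD('n)" "svf t M * svf t N"] svf_pos[OF M t] svf_pos[OF N t] by simp
  finally show ?thesis .
qed

section \<open>Entropy and subadditivity\<close>

text \<open>Nonnegativity of relative entropy for an unnormalised reference weight \<open>g\<close>, from
  \<open>ln x \<le> x - 1\<close> applied termwise.\<close>

lemma gibbs_inequality:
  assumes S: "finite S" and p: "\<And>w. w \<in> S \<Longrightarrow> 0 \<le> p w" "sum p S = 1"
    and g: "\<And>w. w \<in> S \<Longrightarrow> 0 \<le> g w" "\<And>w. w \<in> S \<Longrightarrow> 0 < p w \<Longrightarrow> 0 < g w"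
  shows "(\<Sum>w\<in>S. p w * ln (g w)) + (\<Sum>w\<in>S. entropy_fun (p w)) \<le> ln (\<Sum>w\<in>S. g w)"
proof -
  define G where "G = sum g S"
  obtain w where w: "w \<in> S" "p w \<noteq> 0" using p(2) by (metis sum.neutral zero_neq_one)
  then have "0 < g w" using g(2) p(1) by (simp add: less_le)
  then have G: "0 < G" unfolding G_def using S g(1) w by (intro sum_pos2) auto
  have *: "p w * ln (g w) + entropy_fun (p w) \<le> p w * ln G + g w / G - p w" if w: "w \<in> S" for w
  proof (cases "p w = 0")
    case True
    then show ?thesis using g(1)[OF w] G by (simp add: entropy_fun_def)
  next
    case False
    then have pos: "0 < p w" "0 < g w" using p(1)[OF w] g(2)[OF w] by auto
    have "p w * ln (g w / (p w * G)) \<le> p w * (g w / (p w * G) - 1)"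
      using pos G by (intro mult_left_mono ln_le_minus_one) auto
    then show ?thesis using pos G by (simp add: entropy_fun_def ln_div ln_mult algebra_simps)
  qed
  have "(\<Sum>w\<in>S. p w * ln (g w)) + (\<Sum>w\<in>S. entropy_fun (p w)) \<le> (\<Sum>w\<in>S. p w * ln G + g w / G - p w)"
    unfolding sum.distrib[symmetric] by (rule sum_mono[OF *])
  also have "\<dots> = ln G"
    using G p(2) by (simp add: sum.distrib sum_subtractf flip: sum_distrib_right sum_divide_distrib G_def)
  finally show ?thesis unfolding G_def .
qed

text \<open>Fekete's lemma for \<open>u + C\<close>. The lower bound on \<open>u\<close> keeps the infimum
  finite.\<close>

lemma almost_subadditive_tendsto:
  fixes u :: "nat \<Rightarrow> real"
  assumes sub: "\<And>a b. u (a + b) \<le> u a + u b + C" and low: "\<And>n. - B * real (n + 1) \<le> u n"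
  obtains L where "(\<lambda>n. u n / real n) \<longlonglongrightarrow> L" "\<And>n. n \<ge> 1 \<Longrightarrow> L \<le> (u n + C) / real n"
proof -
  define v where "v n = u n + C" for n
  have vsub: "v (a + b) \<le> v a + v b" for a b using sub[of a b] by (simp add: v_def)
  define V where "V = (\<lambda>n. v n / real n) ` {1..}"
  define L where "L = Inf V"
  have bdd: "bdd_below V"
  proof -
    have "- (2 * \<bar>B\<bar> + \<bar>C\<bar>) \<le> v n / real n" if n: "n \<ge> 1" for n
    proof -
      have "B * (n + 1) \<le> \<bar>B\<bar> * (2 * n)"
        using n by (intro mult_mono) auto
      moreover have "- C \<le> \<bar>C\<bar> * n" using mult_left_mono[of 1 "real n" "\<bar>C\<bar>"] n by linarith
      ultimately have "- ((2 * \<bar>B\<bar> + \<bar>C\<bar>) * n) \<le> v n"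
        using low[of n] by (simp add: v_def algebra_simps)
      moreover have "real n > 0" using n by simp
      ultimately show ?thesis by (simp only: pos_le_divide_eq mult_minus_left)
    qed
    then show ?thesis unfolding V_def bdd_below_def by auto
  qed
  have L_le: "L \<le> v n / real n" if "n \<ge> 1" for n
    unfolding L_def by (intro cInf_lower bdd) (use that in \<open>auto simp: V_def\<close>)
  have mult: "v (k * q + r) \<le> real k * v q + v r" for k q r
  proof (induction k)
    case (Suc k)
    have "v (Suc k * q + r) = v (q + (k * q + r))" by (simp add: algebra_simps)
    also have "\<dots> \<le> v q + v (k * q + r)" by (rule vsub)
    finally show ?case using Suc by (simp add: algebra_simps)
  qed simp
  have "(\<lambda>n. v n / real n) \<longlonglongrightarrow> L"
  proof (rule LIMSEQ_I)
    fix e :: real assume e: "e > 0"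
    obtain q where q: "q \<ge> 1" "v q / q < L + e / 2"
      using cInf_lessD[of V "L + e/2"] e unfolding L_def V_def by auto
    define D where "D = Max ((\<lambda>r. \<bar>v r\<bar>) ` {..q})"
    have D: "\<bar>v r\<bar> \<le> D" if "r \<le> q" for r unfolding D_def using that by (intro Max_ge) auto
    have D0: "0 \<le> D" using D[of 0] by simp
    have up: "v n / n \<le> v q / q + 2 * D / n" if n: "n \<ge> 1" for n
    proof -
      define k r where "k = n div q" and "r = n mod q"
      have n_eq: "n = k * q + r" by (simp add: k_def r_def)
      have r: "r < q" using q by (simp add: r_def)
      have "real k * v q = (real n - real r) * (v q / q)" using q by (simp add: n_eq field_simps)
      then have kq: "real k * v q = n * (v q / q) - r / q * v q"
        by (simp add: left_diff_distrib diff_divide_distrib)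
      have rq: "- (r / q * v q) \<le> D"
      proof -
        have "- (r / q * v q) \<le> \<bar>r / q * v q\<bar>" by (rule abs_ge_minus_self)
        also have "\<dots> = r / q * \<bar>v q\<bar>" by (simp add: abs_mult)
        also have "\<dots> \<le> 1 * D" using r D[of q] by (intro mult_mono) auto
        finally show ?thesis by simp
      qed
      have "v n \<le> real k * v q + v r" using mult[of k q r] by (simp flip: n_eq)
      then have "v n \<le> n * (v q / q) + 2 * D" using kq rq D[of r] r by linarith
      then show ?thesis using n by (simp add: divide_simps algebra_simps)
    qed
    show "\<exists>no. \<forall>n\<ge>no. norm (v n / real n - L) < e"
    proof (intro exI allI impI)
      fix n assume n: "n \<ge> nat \<lceil>4 * D / e\<rceil> + 1"
      then have n1: "n \<ge> 1" and "real n > 4 * D / e" by linarith+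
      then have "2 * D / n < e / 2" using e by (simp add: field_simps)
      then show "norm (v n / real n - L) < e" using up[OF n1] L_le[OF n1] q(2) by simp
    qed
  qed
  moreover have "(\<lambda>n. C / real n) \<longlonglongrightarrow> 0" by (rule lim_const_over_n)
  ultimately have "(\<lambda>n. v n / real n - C / real n) \<longlonglongrightarrow> L - 0" by (intro tendsto_diff)
  then have "(\<lambda>n. u n / real n) \<longlonglongrightarrow> L" by (simp add: v_def add_divide_distrib)
  with L_le that show ?thesis by (simp add: v_def)
qed

lemma continuous_on_entropy_fun: "continuous_on {0..} entropy_fun"
proof -
  \<comment> \<open>\<open>- x ln x = 2 x ln (1 / sqrt x) \<le> 2 sqrt x\<close> gives continuity at \<open>0\<close>.\<close>
  have bound: "0 \<le> entropy_fun x \<and> entropy_fun x \<le> 2 * sqrt x" if x: "0 < x" "x < 1" for x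
  proof
    show "0 \<le> entropy_fun x" using x by (simp add: entropy_fun_def mult_nonneg_nonpos)
    have "ln (1 / sqrt x) \<le> 1 / sqrt x" using ln_le_minus_one[of "1 / sqrt x"] x by simp
    then have "2 * x * ln (1 / sqrt x) \<le> 2 * x * (1 / sqrt x)" using x by (intro mult_left_mono) auto
    also have "2 * x * (1 / sqrt x) = 2 * sqrt x" using real_div_sqrt[of x] x by simp
    finally show "entropy_fun x \<le> 2 * sqrt x"
      using x by (simp add: entropy_fun_def ln_div ln_sqrt)
  qed
  have z: "(entropy_fun \<longlongrightarrow> entropy_fun 0) (at_right 0)"
  proof (rule tendsto_sandwich[of "\<lambda>_. 0" _ _ "\<lambda>x. 2 * sqrt x"])
    show "((\<lambda>x. 2 * sqrt x) \<longlongrightarrow> entropy_fun 0) (at_right 0)"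
      by (rule tendsto_eq_rhs[OF tendsto_mult_left[OF tendsto_real_sqrt[OF tendsto_ident_at]]])
        (simp add: entropy_fun_def)
    show "((\<lambda>x. 0) \<longlongrightarrow> entropy_fun 0) (at_right 0)" by (simp add: entropy_fun_def)
    have ev: "\<forall>\<^sub>F x in at_right 0. x \<in> {0<..<1::real}"
      by (rule eventually_at_right_real) simp
    show "\<forall>\<^sub>F x in at_right 0. 0 \<le> entropy_fun x"
      by (rule eventually_mono[OF ev]) (use bound in auto)
    show "\<forall>\<^sub>F x in at_right 0. entropy_fun x \<le> 2 * sqrt x"
      by (rule eventually_mono[OF ev]) (use bound in auto)
  qed
  have "continuous (at x within {0..}) entropy_fun" if "x \<ge> 0" for x
  proof (cases "x = 0")
    case True
    have "at 0 within {0..} = at_right (0::real)" by (simp add: at_within_Ici_at_right)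
    then show ?thesis using z True by (simp add: continuous_within)
  next
    case False
    with that have x: "x > 0" by simp
    have "continuous_on {0<..} (\<lambda>x::real. - x * ln x)" by (intro continuous_intros) auto
    then have "continuous_on {0<..} entropy_fun"
      by (rule continuous_on_eq) (auto simp: entropy_fun_def)
    then have "isCont entropy_fun x" using x by (simp add: continuous_on_eq_continuous_at open_greaterThan)
    then show ?thesis using continuous_at_imp_continuous_at_within by blast
  qed
  then show ?thesis by (simp add: continuous_on_eq_continuous_within)
qed

lemma entropy_fun_nonneg: "0 \<le> x \<Longrightarrow> x \<le> 1 \<Longrightarrow> 0 \<le> entropy_fun x"
  by (auto simp: entropy_fun_def mult_nonneg_nonpos)

text \<open>Entropy exceeds its convex interpolation by at most an error that is linear in \<open>a\<close>
  and \<open>b\<close>: when they run through probability vectors, the errors add up to the entropy of the two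
  weights, whatever the length of the vectors. After division by the length this makes the entropy rate
  convex.\<close>

lemma entropy_fun_convex_combination_le:
  assumes p: "0 < p" "p < 1" and a: "0 \<le> a" and b: "0 \<le> b"
  shows "entropy_fun (p * a + (1 - p) * b) \<le> p * entropy_fun a + (1 - p) * entropy_fun b
     + (a * entropy_fun p + b * entropy_fun (1 - p))"
proof -
  have mul: "entropy_fun (x * y) = x * entropy_fun y + y * entropy_fun x" if "0 < x" "0 \<le> y" for x y
    using that by (auto simp: entropy_fun_def ln_mult algebra_simps)
  have add: "entropy_fun (x + y) \<le> entropy_fun x + entropy_fun y" if "0 \<le> x" "0 \<le> y" for x y
  proof (cases "x = 0 \<or> y = 0")
    case False
    with that have "x * ln x \<le> x * ln (x + y)" "y * ln y \<le> y * ln (x + y)"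
      by (auto intro!: mult_left_mono simp: less_le)
    then have "x * ln x + y * ln y \<le> (x + y) * ln (x + y)" by (simp add: algebra_simps)
    moreover have "entropy_fun (x + y) = - ((x + y) * ln (x + y))"
      using False that by (simp add: entropy_fun_def algebra_simps)
    ultimately show ?thesis using False by (simp add: entropy_fun_def)
  qed (auto simp: entropy_fun_def)
  have "entropy_fun (p * a + (1 - p) * b) \<le> entropy_fun (p * a) + entropy_fun ((1 - p) * b)"
    using p a b by (intro add) auto
  then show ?thesis using mul[of p a] mul[of "1 - p" b] p a b by simp
qed

section \<open>Finite words\<close>

lemma words_finite: "finite I \<Longrightarrow> finite (words I n)"
  unfolding words_def by (rule finite_lists_length_eq)

lemma words_0 [simp]: "words I 0 = {[]}" by (auto simp: words_def)

lemma words_1 [simp]: "words I (Suc 0) = (\<lambda>i. [i]) ` I"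
  by (auto simp: words_def length_Suc_conv)

lemma card_words: "finite I \<Longrightarrow> card (words I n) = card I ^ n"
  unfolding words_def by (rule card_lists_length_eq)

lemma sum_words_append:
  "(\<Sum>w\<in>words I (a + b). f w) = (\<Sum>u\<in>words I a. \<Sum>v\<in>words I b. f (u @ v))"
proof -
  have "(\<Sum>u\<in>words I a. \<Sum>v\<in>words I b. f (u @ v)) = (\<Sum>(u,v)\<in>words I a \<times> words I b. f (u @ v))"
    by (rule sum.cartesian_product)
  also have "\<dots> = (\<Sum>w\<in>words I (a + b). f w)"
    by (rule sum.reindex_bij_witness[of _ "\<lambda>w. (take a w, drop a w)" "\<lambda>(u,v). u @ v"])
      (auto simp: words_def dest: in_set_takeD in_set_dropD)
  finally show ?thesis ..
qed

text \<open>Blocks of length \<open>q\<close> cut from the offsets \<open>0, \<dots>, q - 1\<close> start at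
  each position exactly once.\<close>

lemma sum_blocks_mod:
  fixes f :: "nat \<Rightarrow> 'a::comm_monoid_add"
  shows "(\<Sum>j<q. \<Sum>r<R. f (j + r * q)) = (\<Sum>k<R * q. f k)"
proof -
  have "(\<Sum>k<R * q. f k) = (\<Sum>r<R. \<Sum>k=r*q..<r*q+q. f k)" by (rule sum.nat_group[symmetric])
  also have "\<dots> = (\<Sum>r<R. \<Sum>j<q. f (j + r * q))"
  proof (rule sum.cong[OF refl])
    show "(\<Sum>k=r*q..<r*q+q. f k) = (\<Sum>j<q. f (j + r * q))" for r
      by (rule sum.reindex_bij_witness[of _ "\<lambda>j. j + r * q" "\<lambda>k. k - r * q"]) auto
  qed
  finally show ?thesis by (simp add: sum.swap[of _ "{..<q}"])
qed

lemma init_word_append: "init_word (a + b) x = init_word a x @ init_word b ((left_shift ^^ a) x)"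
proof -
  have shift: "(left_shift ^^ a) x k = x (a + k)" for k
    by (induction a arbitrary: k) (simp_all add: left_shift_def)
  show ?thesis by (rule nth_equalityI) (auto simp: init_word_def nth_append shift)
qed

lemma length_init_word [simp]: "length (init_word n x) = n" by (simp add: init_word_def)

lemma init_word_0 [simp]: "init_word 0 x = []" by (simp add: init_word_def)

lemma init_word_Suc: "init_word (Suc n) x = init_word n x @ [x n]" by (simp add: init_word_def)

lemma init_word_Suc_Cons: "init_word (Suc n) x = x 0 # init_word n (left_shift x)"
  by (simp add: init_word_def left_shift_def upt_conv_Cons del: upt_Suc flip: map_Suc_upt)

section \<open>Subshifts with an almost submultiplicative weight\<close>

text \<open>All that remains of the matrices: a positive weight on words whose logarithm is subadditive up to
  \<open>C\<close> and decreases at most linearly in the length.\<close>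

locale weighted_subshift =
  fixes I :: "'i set" and K :: "(nat \<Rightarrow> 'i) set" and phi :: "'i list \<Rightarrow> real" and C c :: real
  assumes finite_I: "finite I"
    and K_letters: "\<And>x n. x \<in> K \<Longrightarrow> x n \<in> I"
    and K_nonempty: "K \<noteq> {}"
    and K_shift: "left_shift ` K \<subseteq> K"
    and phi_pos: "\<And>w. set w \<subseteq> I \<Longrightarrow> 0 < phi w"
    and phi_append: "\<And>u v. set u \<subseteq> I \<Longrightarrow> set v \<subseteq> I \<Longrightarrow> ln (phi (u @ v)) \<le> ln (phi u) + ln (phi v) + C"
    and phi_lower: "\<And>w. set w \<subseteq> I \<Longrightarrow> - c * real (length w + 1) \<le> ln (phi w)"
begin

definition lang :: "nat \<Rightarrow> 'i list set" where "lang n = init_word n ` K"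

definition partition_sum :: "nat \<Rightarrow> real" where "partition_sum n = (\<Sum>w\<in>lang n. phi w)"

lemma K_shift_iter: "x \<in> K \<Longrightarrow> (left_shift ^^ k) x \<in> K"
  using K_shift by (induction k) auto

lemma set_init_word: "x \<in> K \<Longrightarrow> set (init_word n x) \<subseteq> I"
  using K_letters by (auto simp: init_word_def)

lemma lang_subset_words: "lang n \<subseteq> words I n"
  using set_init_word by (auto simp: lang_def words_def)

lemma finite_lang: "finite (lang n)"
  using lang_subset_words words_finite[OF finite_I] by (rule finite_subset)

lemma phi_word_pos: "w \<in> words I n \<Longrightarrow> 0 < phi w"
  using phi_pos by (auto simp: words_def)

lemma partition_sum_pos: "0 < partition_sum n"
  unfolding partition_sum_def
proof (rule sum_pos[OF finite_lang])
  show "lang n \<noteq> {}" using K_nonempty by (simp add: lang_def)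
qed (use phi_word_pos lang_subset_words in blast)

lemma partition_sum_submultiplicative: "partition_sum (a + b) \<le> exp C * partition_sum a * partition_sum b"
proof -
  have inj: "inj_on (\<lambda>(u,v). u @ v) (lang a \<times> lang b)" by (auto simp: inj_on_def lang_def)
  have "partition_sum (a + b) \<le> (\<Sum>w\<in>(\<lambda>(u,v). u @ v) ` (lang a \<times> lang b). phi w)"
    unfolding partition_sum_def
  proof (rule sum_mono2)
    show "lang (a + b) \<subseteq> (\<lambda>(u,v). u @ v) ` (lang a \<times> lang b)"
      using K_shift_iter by (force simp: lang_def init_word_append)
    show "0 \<le> phi w" if "w \<in> (\<lambda>(u,v). u @ v) ` (lang a \<times> lang b) - lang (a + b)" for w
      using that by (intro phi_pos[THEN less_imp_le]) (auto dest!: subsetD[OF lang_subset_words] simp: words_def)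
  qed (use finite_lang in auto)
  also have "\<dots> = (\<Sum>(u,v)\<in>lang a \<times> lang b. phi (u @ v))"
    by (subst sum.reindex[OF inj]) (simp add: case_prod_beta comp_def)
  also have "\<dots> \<le> (\<Sum>(u,v)\<in>lang a \<times> lang b. exp C * phi u * phi v)"
  proof (rule sum_mono, clarify)
    fix u v assume "u \<in> lang a" "v \<in> lang b"
    then have uv: "set u \<subseteq> I" "set v \<subseteq> I"
      using lang_subset_words by (fastforce simp: words_def)+
    then have "ln (phi (u @ v)) \<le> ln (exp C * phi u * phi v)"
      using phi_append[OF uv] phi_pos[OF uv(1)] phi_pos[OF uv(2)] by (simp add: ln_mult)
    then show "phi (u @ v) \<le> exp C * phi u * phi v"
      using phi_pos[of "u @ v"] phi_pos[OF uv(1)] phi_pos[OF uv(2)] uv by simp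
  qed
  also have "\<dots> = exp C * (\<Sum>u\<in>lang a. \<Sum>v\<in>lang b. phi u * phi v)"
    by (simp add: mult.assoc sum_distrib_left flip: sum.cartesian_product)
  also have "\<dots> = exp C * partition_sum a * partition_sum b"
    by (simp add: partition_sum_def sum_product mult.assoc)
  finally show ?thesis .
qed

lemma partition_sum_lower: "- c * real (n + 1) \<le> ln (partition_sum n)"
proof -
  obtain x where x: "x \<in> K" using K_nonempty by blast
  have "phi (init_word n x) \<le> partition_sum n"
    unfolding partition_sum_def
  proof (rule member_le_sum[OF _ _ finite_lang])
    show "init_word n x \<in> lang n" using x by (simp add: lang_def)
    show "0 \<le> phi w" if "w \<in> lang n - {init_word n x}" for w
      using that lang_subset_words phi_word_pos by (blast intro: less_imp_le)
  qed
  then have "ln (phi (init_word n x)) \<le> ln (partition_sum n)"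
    using phi_pos[OF set_init_word[OF x]] partition_sum_pos by simp
  then show ?thesis using phi_lower[OF set_init_word[OF x, of n]] by simp
qed

definition pressure_limit :: real where "pressure_limit = lim (\<lambda>n. ln (partition_sum n) / real n)"

lemma pressure_limit_tendsto: "(\<lambda>n. ln (partition_sum n) / real n) \<longlonglongrightarrow> pressure_limit"
proof -
  have sub: "ln (partition_sum (a + b)) \<le> ln (partition_sum a) + ln (partition_sum b) + C" for a b
  proof -
    have "ln (partition_sum (a + b)) \<le> ln (exp C * partition_sum a * partition_sum b)"
      using partition_sum_submultiplicative partition_sum_pos by simp
    then show ?thesis using partition_sum_pos[of a] partition_sum_pos[of b] by (simp add: ln_mult)
  qed
  obtain L where "(\<lambda>n. ln (partition_sum n) / real n) \<longlonglongrightarrow> L"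
    using almost_subadditive_tendsto[of "\<lambda>n. ln (partition_sum n)", OF sub partition_sum_lower] .
  then show ?thesis unfolding pressure_limit_def using limI by blast
qed

section \<open>Invariant measures as cylinder masses\<close>

text \<open>The functions \<open>w \<mapsto> \<mu> [w]\<close> for invariant probability measures carried by
  \<open>K\<close>. Extension by a letter on the right expresses additivity, extension on the left shift
  invariance.\<close>

definition masses :: "('i list \<Rightarrow> real) set" where
  "masses = {m. (\<forall>w. 0 \<le> m w) \<and> (\<forall>w. w \<notin> lang (length w) \<longrightarrow> m w = 0) \<and> m [] = 1 \<and>
     (\<forall>w. m w = (\<Sum>i\<in>I. m (w @ [i]))) \<and> (\<forall>w. m w = (\<Sum>i\<in>I. m (i # w)))}"

definition block_entropy :: "nat \<Rightarrow> ('i list \<Rightarrow> real) \<Rightarrow> real" where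
  "block_entropy n m = (\<Sum>w\<in>words I n. entropy_fun (m w))"

definition block_energy :: "nat \<Rightarrow> ('i list \<Rightarrow> real) \<Rightarrow> real" where
  "block_energy n m = (\<Sum>w\<in>words I n. m w * ln (phi w))"

context
  fixes m assumes m: "m \<in> masses"
begin

lemmas mass_conds = m[unfolded masses_def mem_Collect_eq]
lemmas m_nonneg = mass_conds[THEN conjunct1, rule_format]
lemmas m_off = mass_conds[THEN conjunct2, THEN conjunct1, rule_format]
lemmas m_Nil = mass_conds[THEN conjunct2, THEN conjunct2, THEN conjunct1]
lemmas m_snoc = mass_conds[THEN conjunct2, THEN conjunct2, THEN conjunct2, THEN conjunct1, rule_format]
lemmas m_Cons = mass_conds[THEN conjunct2, THEN conjunct2, THEN conjunct2, THEN conjunct2, rule_format]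

lemma sum_words_right: "(\<Sum>v\<in>words I b. m (u @ v)) = m u"
proof (induction b)
  case (Suc b)
  have "(\<Sum>v\<in>words I (b + 1). m (u @ v)) = (\<Sum>v\<in>words I b. m (u @ v))"
    unfolding sum_words_append
    by (intro sum.cong refl) (simp add: sum.reindex inj_on_def m_snoc[of "u @ _", simplified, symmetric])
  then show ?case using Suc by simp
qed simp

lemma sum_words_left: "(\<Sum>u\<in>words I a. m (u @ v)) = m v"
proof (induction a)
  case (Suc a)
  have "(\<Sum>u\<in>words I (1 + a). m (u @ v)) = (\<Sum>u\<in>words I a. m (u @ v))"
    unfolding sum_words_append sum.swap[of _ "words I a"]
    by (intro sum.cong refl) (simp add: sum.reindex inj_on_def m_Cons[of "_ @ v", simplified, symmetric])
  then show ?case using Suc by simp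
qed simp

lemma sum_words_1: "(\<Sum>w\<in>words I n. m w) = 1"
  using sum_words_right[of "[]" n] m_Nil by simp

lemma m_le_prefix: "v \<in> words I b \<Longrightarrow> m (u @ v) \<le> m u"
  unfolding sum_words_right[of u b, symmetric]
  by (rule member_le_sum[OF _ _ words_finite[OF finite_I]]) (auto simp: m_nonneg)

lemma m_le_suffix: "u \<in> words I a \<Longrightarrow> m (u @ v) \<le> m v"
  unfolding sum_words_left[of v a, symmetric]
  by (rule member_le_sum[OF _ _ words_finite[OF finite_I]]) (auto simp: m_nonneg)

lemma m_le_1: "m w \<le> 1"
proof (cases "set w \<subseteq> I")
  case True
  then show ?thesis using m_le_prefix[of w "length w" "[]"] m_Nil by (simp add: words_def)
next
  case False
  then have "w \<notin> lang (length w)" using lang_subset_words[of "length w"] by (auto simp: words_def)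
  then show ?thesis using m_off[of w] by simp
qed

text \<open>The reference weight is the product of the marginals on the first \<open>a\<close> and the last
  \<open>b\<close> letters.\<close>

lemma block_entropy_subadditive: "block_entropy (a + b) m \<le> block_entropy a m + block_entropy b m"
proof -
  define g where "g w = m (take a w) * m (drop a w)" for w
  have g: "g (u @ v) = m u * m v" if "u \<in> words I a" for u v using that by (simp add: g_def words_def)
  have "(\<Sum>w\<in>words I (a+b). m w * ln (g w)) + (\<Sum>w\<in>words I (a+b). entropy_fun (m w))
     \<le> ln (\<Sum>w\<in>words I (a+b). g w)"
  proof (rule gibbs_inequality)
    show "0 < g w" if w: "w \<in> words I (a+b)" "0 < m w" for w
    proof -
      have wd: "take a w \<in> words I a" "drop a w \<in> words I b"
        using w by (auto simp: words_def dest: in_set_takeD in_set_dropD)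
      have "m w \<le> m (take a w)" "m w \<le> m (drop a w)"
        using m_le_prefix[OF wd(2), of "take a w"] m_le_suffix[OF wd(1), of "drop a w"] by simp_all
      then show ?thesis using w by (simp add: g_def)
    qed
  qed (auto simp: words_finite finite_I m_nonneg sum_words_1 g_def)
  also have "(\<Sum>w\<in>words I (a+b). g w) = 1"
    by (simp add: sum_words_append g sum_words_1 flip: sum_distrib_left)
  finally have "block_entropy (a + b) m \<le> - (\<Sum>w\<in>words I (a+b). m w * ln (g w))"
    by (simp add: block_entropy_def)
  also have "(\<Sum>w\<in>words I (a+b). m w * ln (g w)) =
      (\<Sum>u\<in>words I a. \<Sum>v\<in>words I b. m (u @ v) * (ln (m u) + ln (m v)))"
    unfolding sum_words_append
  proof (intro sum.cong refl)
    fix u v assume uv: "u \<in> words I a" "v \<in> words I b"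
    show "m (u @ v) * ln (g (u @ v)) = m (u @ v) * (ln (m u) + ln (m v))"
    proof (cases "m (u @ v) = 0")
      case False
      then have "0 < m (u @ v)" using m_nonneg[of "u @ v"] by (simp add: less_le)
      then have "0 < m u" "0 < m v" using m_le_prefix[OF uv(2), of u] m_le_suffix[OF uv(1), of v] by auto
      then show ?thesis using uv by (simp add: g ln_mult)
    qed simp
  qed
  also have "\<dots> = (\<Sum>u\<in>words I a. m u * ln (m u)) + (\<Sum>v\<in>words I b. m v * ln (m v))"
    using sum.swap[of "\<lambda>u v. m (u @ v) * ln (m v)" "words I b" "words I a"]
    by (simp add: distrib_left sum.distrib sum_words_right sum_words_left flip: sum_distrib_right)
  also have "- \<dots> = block_entropy a m + block_entropy b m"
    unfolding block_entropy_def sum_negf[symmetric] minus_add_distrib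
    by (intro arg_cong2[of _ _ _ _ "(+)"] sum.cong) (auto simp: entropy_fun_def)
  finally show ?thesis .
qed

lemma block_energy_subadditive: "block_energy (a + b) m \<le> block_energy a m + block_energy b m + C"
proof -
  have "block_energy (a + b) m \<le> (\<Sum>u\<in>words I a. \<Sum>v\<in>words I b. m (u @ v) * (ln (phi u) + ln (phi v) + C))"
    unfolding block_energy_def sum_words_append
    by (intro sum_mono mult_left_mono phi_append m_nonneg) (auto simp: words_def)
  also have "\<dots> = block_energy a m + block_energy b m + C"
    using sum.swap[of "\<lambda>u v. m (u @ v) * ln (phi v)" "words I b" "words I a"]
    by (simp add: distrib_left sum.distrib sum_words_right sum_words_left sum_words_1 block_energy_def
        flip: sum_distrib_right)
  finally show ?thesis .
qed

lemma block_entropy_nonneg: "0 \<le> block_entropy n m"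
  unfolding block_entropy_def by (intro sum_nonneg entropy_fun_nonneg m_nonneg m_le_1)

lemma block_energy_lower: "- c * real (n + 1) \<le> block_energy n m"
proof -
  have "- c * real (n + 1) = (\<Sum>w\<in>words I n. m w * (- c * real (n + 1)))"
    unfolding sum_distrib_right[symmetric] sum_words_1 by simp
  also have "\<dots> \<le> block_energy n m"
    unfolding block_energy_def by (intro sum_mono mult_left_mono m_nonneg) (use phi_lower in \<open>force simp: words_def\<close>)
  finally show ?thesis .
qed

text \<open>The upper half of the variational principle, with the weight of the words as reference.\<close>

lemma block_free_energy_le_ln_partition_sum: "block_entropy n m + block_energy n m \<le> ln (partition_sum n)"
proof -
  have off: "m w = 0" if "w \<in> words I n - lang n" for w
    using that m_off[of w] by (auto simp: words_def)
  have s: "(\<Sum>w\<in>lang n. f w) = (\<Sum>w\<in>words I n. f w)" if "\<And>w. m w = 0 \<Longrightarrow> f w = 0" for f :: "'i list \<Rightarrow> real"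
    using off that by (intro sum.mono_neutral_left words_finite finite_I lang_subset_words) auto
  have "(\<Sum>w\<in>lang n. m w * ln (phi w)) + (\<Sum>w\<in>lang n. entropy_fun (m w)) \<le> ln (\<Sum>w\<in>lang n. phi w)"
  proof (rule gibbs_inequality)
    show "sum m (lang n) = 1" by (subst s) (auto simp: sum_words_1)
    show "0 \<le> phi w" "0 < phi w" if "w \<in> lang n" for w
      using that lang_subset_words phi_word_pos by (blast intro: less_imp_le)+
  qed (auto simp: finite_lang m_nonneg)
  then show ?thesis
    by (simp add: s entropy_fun_def[of 0] block_energy_def block_entropy_def partition_sum_def)
qed

end

definition entropy_rate :: "('i list \<Rightarrow> real) \<Rightarrow> real" where "entropy_rate m = lim (\<lambda>n. block_entropy n m / real n)"
definition energy_rate :: "('i list \<Rightarrow> real) \<Rightarrow> real" where "energy_rate m = lim (\<lambda>n. block_energy n m / real n)"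

lemma block_entropy_tendsto:
  assumes m: "m \<in> masses"
  shows "(\<lambda>n. block_entropy n m / real n) \<longlonglongrightarrow> entropy_rate m" and "n \<ge> 1 \<Longrightarrow> entropy_rate m \<le> block_entropy n m / real n"
proof -
  obtain L where L: "(\<lambda>n. block_entropy n m / real n) \<longlonglongrightarrow> L" "\<And>n. n \<ge> 1 \<Longrightarrow> L \<le> (block_entropy n m + 0) / real n"
    using almost_subadditive_tendsto[of "\<lambda>n. block_entropy n m" 0 0] block_entropy_subadditive[OF m] block_entropy_nonneg[OF m] by auto
  moreover have "entropy_rate m = L" unfolding entropy_rate_def using L(1) by (rule limI)
  ultimately show "(\<lambda>n. block_entropy n m / real n) \<longlonglongrightarrow> entropy_rate m" "n \<ge> 1 \<Longrightarrow> entropy_rate m \<le> block_entropy n m / real n"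
    by simp_all
qed

lemma block_energy_tendsto:
  assumes m: "m \<in> masses"
  shows "(\<lambda>n. block_energy n m / real n) \<longlonglongrightarrow> energy_rate m" and "n \<ge> 1 \<Longrightarrow> energy_rate m \<le> (block_energy n m + C) / real n"
proof -
  obtain L where L: "(\<lambda>n. block_energy n m / real n) \<longlonglongrightarrow> L" "\<And>n. n \<ge> 1 \<Longrightarrow> L \<le> (block_energy n m + C) / real n"
    using almost_subadditive_tendsto[of "\<lambda>n. block_energy n m", OF block_energy_subadditive[OF m] block_energy_lower[OF m]] by blast
  moreover have "energy_rate m = L" unfolding energy_rate_def using L(1) by (rule limI)
  ultimately show "(\<lambda>n. block_energy n m / real n) \<longlonglongrightarrow> energy_rate m" "n \<ge> 1 \<Longrightarrow> energy_rate m \<le> (block_energy n m + C) / real n"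
    by simp_all
qed

lemma free_energy_le_pressure_limit: "m \<in> masses \<Longrightarrow> entropy_rate m + energy_rate m \<le> pressure_limit"
proof (rule tendsto_le[OF sequentially_bot pressure_limit_tendsto tendsto_add[OF block_entropy_tendsto(1) block_energy_tendsto(1)]])
  assume m: "m \<in> masses"
  then show "\<forall>\<^sub>F n in sequentially. block_entropy n m / real n + block_energy n m / real n \<le> ln (partition_sum n) / real n"
    using block_free_energy_le_ln_partition_sum by (intro always_eventually) (simp add: divide_right_mono flip: add_divide_distrib)
qed

text \<open>Attaining the pressure is expressed by inequalities for finite blocks, which are closed conditions
  on \<open>m\<close>, whereas the entropy rate need not be continuous. The two descriptions agree
  (\<open>maximisers_iff\<close>) because, up to \<open>C / q\<close>, the rates are at most the averages over blocks of length \<open>q\<close>.\<close>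

definition maximisers :: "('i list \<Rightarrow> real) set" where
  "maximisers = {m \<in> masses. \<forall>q\<ge>1. real q * pressure_limit \<le> block_entropy q m + block_energy q m + C}"

lemma maximisers_iff: "m \<in> maximisers \<longleftrightarrow> m \<in> masses \<and> pressure_limit = entropy_rate m + energy_rate m"
proof (intro iffI conjI)
  assume m': "m \<in> maximisers"
  then show m: "m \<in> masses" by (simp add: maximisers_def)
  have "pressure_limit \<le> entropy_rate m + energy_rate m"
  proof (rule tendsto_le[OF sequentially_bot _ tendsto_const])
    have "(\<lambda>n. C / real n) \<longlonglongrightarrow> 0" by (rule lim_const_over_n)
    then show "(\<lambda>n. block_entropy n m / real n + block_energy n m / real n + C / real n) \<longlonglongrightarrow> entropy_rate m + energy_rate m"
      using tendsto_add[OF tendsto_add[OF block_entropy_tendsto(1)[OF m] block_energy_tendsto(1)[OF m]]] by fastforce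
    show "\<forall>\<^sub>F n in sequentially. pressure_limit \<le> block_entropy n m / real n + block_energy n m / real n + C / real n"
      using eventually_ge_at_top[of 1]
    proof eventually_elim
      case (elim n)
      then have "real n * pressure_limit \<le> block_entropy n m + block_energy n m + C"
        using m' by (simp add: maximisers_def)
      then show ?case using elim by (simp add: field_simps)
    qed
  qed
  then show "pressure_limit = entropy_rate m + energy_rate m" using free_energy_le_pressure_limit[OF m] by simp
next
  assume "m \<in> masses \<and> pressure_limit = entropy_rate m + energy_rate m"
  then have m: "m \<in> masses" and pressure_limit: "pressure_limit = entropy_rate m + energy_rate m" by auto
  have "real q * pressure_limit \<le> block_entropy q m + block_energy q m + C" if q: "q \<ge> 1" for q
  proof -
    have "pressure_limit \<le> block_entropy q m / q + (block_energy q m + C) / q"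
      unfolding pressure_limit by (intro add_mono block_entropy_tendsto(2) block_energy_tendsto(2) m q)
    then show ?thesis using q by (simp add: field_simps)
  qed
  with m show "m \<in> maximisers" by (simp add: maximisers_def)
qed

text \<open>The sum of entropy and energy rate is at most the interpolation of its values at the two
  components, and neither of these exceeds the maximum, so equality at the combination forces equality at
  both.\<close>

lemma maximisers_face:
  assumes m: "(\<lambda>w. p * n1 w + (1 - p) * n2 w) \<in> maximisers" and p: "0 < p" "p < 1"
    and n: "n1 \<in> masses" "n2 \<in> masses"
  shows "n1 \<in> maximisers" "n2 \<in> maximisers"
proof -
  define m where "m = (\<lambda>w. p * n1 w + (1 - p) * n2 w)"
  have mm: "m \<in> masses" "pressure_limit = entropy_rate m + energy_rate m"
    using m maximisers_iff by (auto simp: m_def)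
  have block_energy: "block_energy n m = p * block_energy n n1 + (1 - p) * block_energy n n2" for n
    unfolding block_energy_def sum_distrib_left sum.distrib[symmetric]
    by (intro sum.cong refl) (simp add: m_def algebra_simps)
  define D where "D = entropy_fun p + entropy_fun (1 - p)"
  have block_entropy: "block_entropy n m \<le> p * block_entropy n n1 + (1 - p) * block_entropy n n2 + D" for n
  proof -
    have "block_entropy n m \<le> (\<Sum>w\<in>words I n. p * entropy_fun (n1 w) + (1 - p) * entropy_fun (n2 w)
        + (n1 w * entropy_fun p + n2 w * entropy_fun (1 - p)))"
      unfolding block_entropy_def m_def by (intro sum_mono entropy_fun_convex_combination_le p m_nonneg n)
    also have "\<dots> = p * block_entropy n n1 + (1 - p) * block_entropy n n2 + D"
      by (simp add: block_entropy_def D_def sum.distrib sum_words_1[OF n(1)] sum_words_1[OF n(2)]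
          flip: sum_distrib_left sum_distrib_right)
    finally show ?thesis .
  qed
  have "pressure_limit \<le> p * (entropy_rate n1 + energy_rate n1) + (1 - p) * (entropy_rate n2 + energy_rate n2)"
  proof (rule tendsto_le[OF sequentially_bot])
    have D0: "(\<lambda>n. D / real n) \<longlonglongrightarrow> 0" by (rule lim_const_over_n)
    have "(\<lambda>k. p * (block_entropy k n1 / k + block_energy k n1 / k) + (1 - p) * (block_entropy k n2 / k + block_energy k n2 / k) + D / k)
        \<longlonglongrightarrow> p * (entropy_rate n1 + energy_rate n1) + (1 - p) * (entropy_rate n2 + energy_rate n2) + 0"
      by (intro tendsto_add tendsto_mult_left D0 block_entropy_tendsto(1) block_energy_tendsto(1) n)
    then show "(\<lambda>k. p * (block_entropy k n1 / k + block_energy k n1 / k) + (1 - p) * (block_entropy k n2 / k + block_energy k n2 / k) + D / k)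
        \<longlonglongrightarrow> p * (entropy_rate n1 + energy_rate n1) + (1 - p) * (entropy_rate n2 + energy_rate n2)"
          by simp
    show "(\<lambda>k. block_entropy k m / k + block_energy k m / k) \<longlonglongrightarrow> pressure_limit"
      unfolding mm(2) by (intro tendsto_add block_entropy_tendsto block_energy_tendsto mm)
    have "block_entropy k m / k + block_energy k m / k \<le> p * (block_entropy k n1 / k + block_energy k n1 / k) + (1 - p) * (block_entropy k n2 / k + block_energy k n2 / k) + D / k" for k :: nat
    proof -
      have "(block_entropy k m + block_energy k m) / k \<le> (p * (block_entropy k n1 + block_energy k n1) + (1 - p) * (block_entropy k n2 + block_energy k n2) + D) / k"
        using block_entropy[of k] block_energy[of k] by (intro divide_right_mono) (auto simp: algebra_simps)
      then show ?thesis by (simp add: add_divide_distrib distrib_left)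
    qed
    then show "\<forall>\<^sub>F k in sequentially. block_entropy k m / k + block_energy k m / k
       \<le> p * (block_entropy k n1 / k + block_energy k n1 / k) + (1 - p) * (block_entropy k n2 / k + block_energy k n2 / k) + D / k"
      by (intro always_eventually) blast
  qed
  moreover have le: "entropy_rate n1 + energy_rate n1 \<le> pressure_limit" "entropy_rate n2 + energy_rate n2 \<le> pressure_limit"
    using n free_energy_le_pressure_limit by auto
  moreover have "p * (entropy_rate n1 + energy_rate n1) \<le> p * pressure_limit" "(1 - p) * (entropy_rate n2 + energy_rate n2) \<le> (1 - p) * pressure_limit"
    using p le by (auto intro!: mult_left_mono)
  moreover have pP: "p * pressure_limit + (1 - p) * pressure_limit = pressure_limit" by (simp add: algebra_simps)
  ultimately have "p * (entropy_rate n1 + energy_rate n1) = p * pressure_limit" "(1 - p) * (entropy_rate n2 + energy_rate n2) = (1 - p) * pressure_limit"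
    using pP by linarith+
  then show "n1 \<in> maximisers" "n2 \<in> maximisers" using p n by (auto simp: maximisers_iff)
qed

end

section \<open>Empirical masses of Gibbs distributions\<close>

lemma take_drop_init_word:
  assumes "a + q \<le> N"
  shows "take q (drop a (init_word N x)) = init_word q ((left_shift ^^ a) x)"
proof -
  have "N = a + (q + (N - a - q))" using assms by simp
  then have "init_word N x = init_word a x @ init_word q ((left_shift ^^ a) x) @
     init_word (N - a - q) ((left_shift ^^ q) ((left_shift ^^ a) x))"
    by (metis init_word_append)
  then show ?thesis by simp
qed

text \<open>A product of block probabilities over consecutive disjoint blocks is a probability vector on the
  letters in those blocks; each of the \<open>j + s\<close> free letters before and after them contributes a
  factor \<open>card I\<close>.\<close>

lemma sum_words_prod_blocks:
  fixes m :: "'i list \<Rightarrow> real"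
  assumes I: "finite I" and m: "(\<Sum>w\<in>words I q. m w) = 1"
  shows "(\<Sum>w\<in>words I (j + (R * q + s)). \<Prod>r<R. m (take q (drop (j + r * q) w))) = real (card I) ^ (j + s)"
proof -
  have *: "(\<Sum>w\<in>words I (R * q + s). \<Prod>r<R. m (take q (drop (r * q) w))) = real (card I) ^ s"
  proof (induction R)
    case 0
    then show ?case by (simp add: card_words[OF I])
  next
    case (Suc R)
    have "(\<Sum>w\<in>words I (q + (R * q + s)). \<Prod>r<Suc R. m (take q (drop (r * q) w)))
       = (\<Sum>u\<in>words I q. \<Sum>v\<in>words I (R * q + s). m u * (\<Prod>r<R. m (take q (drop (r * q) v))))"
      unfolding sum_words_append
      by (intro sum.cong refl) (auto simp: prod.lessThan_Suc_shift words_def simp del: prod.lessThan_Suc)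
    also have "\<dots> = real (card I) ^ s"
      by (simp add: Suc m flip: sum_distrib_left sum_distrib_right)
    finally show ?case by (simp add: add.assoc)
  qed
  have "(\<Sum>w\<in>words I (j + (R * q + s)). \<Prod>r<R. m (take q (drop (j + r * q) w)))
     = (\<Sum>u\<in>words I j. \<Sum>v\<in>words I (R * q + s). \<Prod>r<R. m (take q (drop (r * q) v)))"
    unfolding sum_words_append by (intro sum.cong refl) (auto simp: words_def)
  then show ?thesis by (simp add: * card_words[OF I] power_add)
qed

context weighted_subshift
begin

lemma phi_upper: obtains D where "0 \<le> D" "\<And>w. set w \<subseteq> I \<Longrightarrow> ln (phi w) \<le> D * real (length w + 1)"
proof -
  define D where "D = \<bar>ln (phi [])\<bar> + (\<Sum>i\<in>I. \<bar>ln (phi [i])\<bar>) + \<bar>C\<bar>"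
  have s: "0 \<le> (\<Sum>i\<in>I. \<bar>ln (phi [i])\<bar>)" by (simp add: sum_nonneg)
  have letter: "ln (phi [i]) + C \<le> D" if "i \<in> I" for i
    using member_le_sum[OF that, of "\<lambda>i. \<bar>ln (phi [i])\<bar>"] finite_I by (simp add: D_def)
  have "ln (phi w) \<le> D * real (length w + 1)" if "set w \<subseteq> I" for w
    using that
  proof (induction w)
    case Nil
    have "ln (phi []) \<le> D" using s unfolding D_def by linarith
    then show ?case by simp
  next
    case (Cons i w)
    then have "ln (phi ([i] @ w)) \<le> ln (phi [i]) + ln (phi w) + C" by (intro phi_append) auto
    then show ?case using Cons letter[of i] by (simp add: algebra_simps)
  qed
  moreover have "0 \<le> D" using s by (simp add: D_def)
  ultimately show ?thesis using that by blast
qed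

text \<open>The \<open>j\<close> letters before and the \<open>s\<close> letters after the blocks cost only a
  term linear in \<open>j + s\<close>.\<close>

lemma phi_blocks_le:
  assumes D: "\<And>w. set w \<subseteq> I \<Longrightarrow> ln (phi w) \<le> D * real (length w + 1)"
    and w: "set w \<subseteq> I" "length w = j + (R * q + s)"
  shows "ln (phi w) \<le> (\<Sum>r<R. ln (phi (take q (drop (j + r * q) w))) + C) + D * real (j + s + 2) + C"
proof -
  have *: "ln (phi w) \<le> (\<Sum>r<R. ln (phi (take q (drop (r * q) w))) + C) + D * real (s + 1)"
    if "set w \<subseteq> I" "length w = R * q + s" for w
    using that
  proof (induction R arbitrary: w)
    case 0
    then show ?case using D[of w] by simp
  next
    case (Suc R)
    have sub: "set (take q w) \<subseteq> I" "set (drop q w) \<subseteq> I"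
      using Suc.prems(1) by (auto dest: in_set_takeD in_set_dropD)
    have "ln (phi w) \<le> ln (phi (take q w)) + ln (phi (drop q w)) + C"
      using phi_append[OF sub] by simp
    moreover have "ln (phi (drop q w)) \<le> (\<Sum>r<R. ln (phi (take q (drop (r * q) (drop q w)))) + C) + D * real (s + 1)"
      by (rule Suc.IH) (use sub Suc.prems in auto)
    ultimately show ?case
      by (simp add: sum.lessThan_Suc_shift add.commute del: sum.lessThan_Suc)
  qed
  have sub: "set (take j w) \<subseteq> I" "set (drop j w) \<subseteq> I"
    using w(1) by (auto dest: in_set_takeD in_set_dropD)
  have "ln (phi w) \<le> ln (phi (take j w)) + ln (phi (drop j w)) + C"
    using phi_append[OF sub] by simp
  moreover have "ln (phi (take j w)) \<le> D * real (j + 1)" using D[OF sub(1)] w(2) by simp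
  moreover have "ln (phi (drop j w)) \<le> (\<Sum>r<R. ln (phi (take q (drop (r * q) (drop j w)))) + C) + D * real (s + 1)"
    by (rule *) (use sub w in auto)
  ultimately show ?thesis by (simp add: add.commute distrib_left)
qed

text \<open>Some point of \<open>K\<close> beginning with \<open>w\<close>. Reading blocks in an infinite word
  makes the empirical masses exactly additive, also for blocks that run beyond position
  \<open>N\<close>.\<close>

definition extension :: "nat \<Rightarrow> 'i list \<Rightarrow> nat \<Rightarrow> 'i" where
  "extension N w = (SOME x. x \<in> K \<and> init_word N x = w)"

lemma extension: "w \<in> lang N \<Longrightarrow> extension N w \<in> K" "w \<in> lang N \<Longrightarrow> init_word N (extension N w) = w"
  using someI_ex[of "\<lambda>x. x \<in> K \<and> init_word N x = w"] by (auto simp: lang_def extension_def)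

definition gibbs :: "nat \<Rightarrow> 'i list \<Rightarrow> real" where "gibbs N w = phi w / partition_sum N"

lemma gibbs_pos: "w \<in> lang N \<Longrightarrow> 0 < gibbs N w"
  unfolding gibbs_def using phi_word_pos lang_subset_words partition_sum_pos by (intro divide_pos_pos) auto

lemma gibbs_sum: "(\<Sum>w\<in>lang N. gibbs N w) = 1"
  using partition_sum_pos[of N] by (simp add: gibbs_def partition_sum_def flip: sum_divide_distrib)

definition block :: "nat \<Rightarrow> nat \<Rightarrow> 'i list \<Rightarrow> nat \<Rightarrow> 'i list" where
  "block N k w n = init_word n ((left_shift ^^ k) (extension N w))"

lemma block_lang: "w \<in> lang N \<Longrightarrow> block N k w n \<in> lang n"
  unfolding block_def lang_def[of n] by (intro imageI K_shift_iter extension(1))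

text \<open>The cylinder masses of the average of the first \<open>N\<close> shifted copies of the measure
  that gives the point \<open>extension N w\<close> the mass \<open>gibbs N w\<close>.\<close>

definition empirical :: "nat \<Rightarrow> 'i list \<Rightarrow> real" where
  "empirical N v = (\<Sum>k<N. \<Sum>w\<in>lang N. gibbs N w * of_bool (block N k w (length v) = v)) / real N"

lemma empirical_nonneg: "0 \<le> empirical N v"
  unfolding empirical_def by (intro divide_nonneg_nonneg sum_nonneg mult_nonneg_nonneg) (auto simp: gibbs_pos less_imp_le)

lemma empirical_off: "v \<notin> lang (length v) \<Longrightarrow> empirical N v = 0"
  unfolding empirical_def by (auto intro!: sum.neutral) (metis block_lang)

lemma empirical_snoc: "empirical N v = (\<Sum>i\<in>I. empirical N (v @ [i]))"
proof -
  have "(\<Sum>i\<in>I. of_bool (block N k w (Suc (length v)) = v @ [i])) = (of_bool (block N k w (length v) = v) :: real)"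
    if "w \<in> lang N" for k w
  proof -
    define y where "y = (left_shift ^^ k) (extension N w)"
    have "y (length v) \<in> I" unfolding y_def by (intro K_letters K_shift_iter extension(1) that)
    then have "(\<Sum>i\<in>I. of_bool (y (length v) = i)) = (1 :: real)"
      by (simp add: of_bool_def finite_I)
    then show ?thesis
      unfolding block_def y_def[symmetric]
      by (cases "init_word (length v) y = v") (simp_all add: init_word_Suc)
  qed
  then have "empirical N v = (\<Sum>k<N. \<Sum>w\<in>lang N. \<Sum>i\<in>I. gibbs N w * of_bool (block N k w (Suc (length v)) = v @ [i])) / real N"
    by (simp add: empirical_def flip: sum_distrib_left)
  also have "\<dots> = (\<Sum>i\<in>I. empirical N (v @ [i]))"
    by (simp add: empirical_def sum.swap[of _ I] flip: sum_divide_distrib)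
  finally show ?thesis .
qed

text \<open>Approximate shift invariance: the sum over the first \<open>N\<close> shifts changes only in its
  first and last term.\<close>

lemma empirical_Cons: "\<bar>empirical N v - (\<Sum>i\<in>I. empirical N (i # v))\<bar> \<le> 1 / real N"
proof -
  define T where "T k = (\<Sum>w\<in>lang N. gibbs N w * of_bool (block N k w (length v) = v))" for k
  have T: "0 \<le> T k" "T k \<le> 1" for k
  proof -
    show "0 \<le> T k" unfolding T_def by (intro sum_nonneg mult_nonneg_nonneg) (auto simp: gibbs_pos less_imp_le)
    have "T k \<le> (\<Sum>w\<in>lang N. gibbs N w)"
      unfolding T_def by (intro sum_mono) (auto simp: gibbs_pos less_imp_le)
    then show "T k \<le> 1" by (simp add: gibbs_sum)
  qed
  have "(\<Sum>i\<in>I. of_bool (block N k w (Suc (length v)) = i # v)) = (of_bool (block N (Suc k) w (length v) = v) :: real)"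
    if "w \<in> lang N" for k w
  proof -
    define y where "y = (left_shift ^^ k) (extension N w)"
    have "y 0 \<in> I" unfolding y_def by (intro K_letters K_shift_iter extension(1) that)
    then have "(\<Sum>i\<in>I. of_bool (y 0 = i)) = (1 :: real)"
      by (simp add: of_bool_def finite_I)
    then show ?thesis
      unfolding block_def funpow.simps comp_def y_def[symmetric]
      by (cases "init_word (length v) (left_shift y) = v") (simp_all add: init_word_Suc_Cons)
  qed
  then have "(\<Sum>k<N. T (Suc k)) / N =
      (\<Sum>k<N. \<Sum>w\<in>lang N. \<Sum>i\<in>I. gibbs N w * of_bool (block N k w (Suc (length v)) = i # v)) / real N"
    by (simp add: T_def flip: sum_distrib_left)
  also have "\<dots> = (\<Sum>i\<in>I. empirical N (i # v))"
    by (simp add: empirical_def sum.swap[of _ I] flip: sum_divide_distrib)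
  finally have "(\<Sum>i\<in>I. empirical N (i # v)) = (\<Sum>k<N. T (Suc k)) / N" ..
  then have "empirical N v - (\<Sum>i\<in>I. empirical N (i # v)) = (\<Sum>k<N. T k - T (Suc k)) / N"
    by (simp add: empirical_def T_def sum_subtractf diff_divide_distrib)
  also have "(\<Sum>k<N. T k - T (Suc k)) = T 0 - T N" by (rule sum_lessThan_telescope')
  finally have "\<bar>empirical N v - (\<Sum>i\<in>I. empirical N (i # v))\<bar> = \<bar>T 0 - T N\<bar> / N"
    by simp
  also have "\<dots> \<le> 1 / N" using T[of 0] T[of N] by (intro divide_right_mono) auto
  finally show ?thesis .
qed

lemma empirical_expectation:
  assumes "N \<ge> 1"
  shows "real N * (\<Sum>v\<in>words I n. empirical N v * f v) = (\<Sum>k<N. \<Sum>w\<in>lang N. gibbs N w * f (block N k w n))"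
proof -
  have "real N * (\<Sum>v\<in>words I n. empirical N v * f v) =
    (\<Sum>v\<in>words I n. (\<Sum>k<N. \<Sum>w\<in>lang N. gibbs N w * of_bool (block N k w n = v)) * f v)"
    unfolding sum_distrib_left using assms by (intro sum.cong refl) (auto simp: empirical_def words_def)
  also have "\<dots> = (\<Sum>k<N. \<Sum>w\<in>lang N. \<Sum>v\<in>words I n. gibbs N w * of_bool (block N k w n = v) * f v)"
    by (simp add: sum_distrib_right sum.swap[of _ "words I n"])
  also have "\<dots> = (\<Sum>k<N. \<Sum>w\<in>lang N. gibbs N w * f (block N k w n))"
  proof (intro sum.cong refl)
    fix k w assume "w \<in> lang N"
    then have "block N k w n \<in> words I n" using block_lang lang_subset_words by blast
    then show "(\<Sum>v\<in>words I n. gibbs N w * of_bool (block N k w n = v) * f v) = gibbs N w * f (block N k w n)"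
      by (subst sum.remove[OF words_finite[OF finite_I]]) (auto intro!: sum.neutral)
  qed
  finally show ?thesis .
qed

lemma empirical_sum_words: "N \<ge> 1 \<Longrightarrow> (\<Sum>v\<in>words I n. empirical N v) = 1"
  using empirical_expectation[of N "\<lambda>_. 1" n] by (simp add: gibbs_sum)

lemma empirical_Nil: "N \<ge> 1 \<Longrightarrow> empirical N [] = 1"
  using empirical_sum_words[of N 0] by simp

lemma empirical_le_1:
  assumes N: "N \<ge> 1" shows "empirical N v \<le> 1"
proof (cases "v \<in> words I (length v)")
  case True
  have "empirical N v \<le> (\<Sum>v\<in>words I (length v). empirical N v)"
    using True by (intro member_le_sum words_finite finite_I) (auto simp: empirical_nonneg)
  then show ?thesis using empirical_sum_words[OF N] by simp
next
  case False
  then show ?thesis using empirical_off[of v] lang_subset_words by fastforce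
qed

lemma empirical_block_pos:
  assumes w: "w \<in> lang N" and k: "k < N"
  shows "0 < empirical N (block N k w n)"
proof -
  define v where "v = block N k w n"
  have len: "length v = n" by (simp add: v_def block_def)
  let ?f = "\<lambda>k w. gibbs N w * of_bool (block N k w n = v)"
  have nn: "0 \<le> ?f k w" if "w \<in> lang N" for k w using gibbs_pos[OF that] by simp
  have "0 < ?f k w" using gibbs_pos[OF w] by (simp add: v_def)
  then have "0 < (\<Sum>w\<in>lang N. ?f k w)" using w nn by (intro sum_pos2[OF finite_lang w]) auto
  then have "0 < (\<Sum>k<N. \<Sum>w\<in>lang N. ?f k w)"
    using k nn by (intro sum_pos2[of _ k]) (auto intro!: sum_nonneg)
  then show ?thesis unfolding empirical_def v_def[symmetric] len using k by simp
qed

text \<open>For each offset \<open>j\<close>, cut words of length \<open>N\<close> into blocks of length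
  \<open>q\<close> and compare the Gibbs distribution, whose entropy plus energy is exactly \<open>ln
  (partition_sum N)\<close>, with the product of the empirical masses of the blocks. Summing over the offsets
  places a block at every position, and the average over all positions of the logarithm of the empirical mass
  is by definition minus the empirical block entropy. The \<open>s\<close> letters outside the blocks produce
  the error terms.\<close>

lemma empirical_finite_inequality:
  assumes D: "0 \<le> D" "\<And>w. set w \<subseteq> I \<Longrightarrow> ln (phi w) \<le> D * real (length w + 1)"
    and q: "q \<ge> 1" and N: "N = R * q + s" "q \<le> s"
  shows "real q * ln (partition_sum N) \<le> real N * (block_entropy q (empirical N) + block_energy q (empirical N) + C)
     + real s * \<bar>c * real (q + 1) - C\<bar> + real q * (D * real (s + 2) + C + real s * ln (card I))"
proof -
  have N1: "N \<ge> 1" using N q by simp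
  define F where "F = D * real (s + 2) + C + real s * ln (card I)"
  define B where "B = \<bar>c * real (q + 1) - C\<bar>"
  \<comment> \<open>\<open>th\<close> is the contribution of one block, \<open>Th k\<close> its Gibbs average at position \<open>k\<close>.\<close>
  define th where "th v = ln (phi v) + C - ln (empirical N v)" for v
  define Th where "Th k = (\<Sum>w\<in>lang N. gibbs N w * th (block N k w q))" for k
  have offset: "ln (partition_sum N) \<le> (\<Sum>r<R. Th (j + r * q)) + F" if j: "j < q" for j
  proof -
    define s' where "s' = s - j"
    have s': "N = j + (R * q + s')" "j + s' = s" using N j by (auto simp: s'_def)
    define g where "g w = (\<Prod>r<R. empirical N (take q (drop (j + r * q) w)))" for w
    have blk: "take q (drop (j + r * q) w) = block N (j + r * q) w q" "j + r * q < N"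
      if "w \<in> lang N" "r < R" for w r
    proof -
      have "r * q + q \<le> R * q" using that(2) mult_le_mono1[of "Suc r" R q] by simp
      then have le: "j + r * q + q \<le> N" using s'(1) by simp
      show "take q (drop (j + r * q) w) = block N (j + r * q) w q"
        using take_drop_init_word[OF le, of "extension N w"] extension(2)[OF that(1)] by (simp add: block_def)
      show "j + r * q < N" using le q by simp
    qed
    have g: "g w = (\<Prod>r<R. empirical N (block N (j + r * q) w q))" if "w \<in> lang N" for w
      unfolding g_def using blk(1)[OF that] by simp
    have gpos: "0 < g w" if "w \<in> lang N" for w
      unfolding g[OF that] using that blk(2)[OF that] by (intro prod_pos) (auto intro!: empirical_block_pos)
    have "(\<Sum>w\<in>lang N. gibbs N w * ln (g w)) + (\<Sum>w\<in>lang N. entropy_fun (gibbs N w)) \<le> ln (\<Sum>w\<in>lang N. g w)"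
      by (rule gibbs_inequality) (auto simp: finite_lang gibbs_sum gpos gibbs_pos less_imp_le)
    also have "\<dots> \<le> ln (real (card I) ^ s)"
    proof -
      have "(\<Sum>w\<in>lang N. g w) \<le> (\<Sum>w\<in>words I N. g w)"
        by (intro sum_mono2 words_finite finite_I lang_subset_words) (auto simp: g_def empirical_nonneg prod_nonneg)
      also have "\<dots> = real (card I) ^ s"
        using sum_words_prod_blocks[OF finite_I empirical_sum_words[OF N1],
            where j = j and R = R and q = q and s = s'] s' by (simp add: g_def)
      finally have "(\<Sum>w\<in>lang N. g w) \<le> real (card I) ^ s" .
      moreover have "0 < (\<Sum>w\<in>lang N. g w)"
        using K_nonempty gpos by (intro sum_pos finite_lang) (auto simp: lang_def)
      ultimately show ?thesis by (subst ln_le_cancel_iff) linarith+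
    qed
    also have "(\<Sum>w\<in>lang N. entropy_fun (gibbs N w)) = ln (partition_sum N) - (\<Sum>w\<in>lang N. gibbs N w * ln (phi w))"
    proof -
      have "entropy_fun (gibbs N w) = gibbs N w * ln (partition_sum N) - gibbs N w * ln (phi w)" if w: "w \<in> lang N" for w
      proof -
        have "0 < phi w" using w phi_word_pos lang_subset_words by blast
        then have L: "ln (gibbs N w) = ln (phi w) - ln (partition_sum N)"
          unfolding gibbs_def using partition_sum_pos[of N] by (simp add: ln_div)
        show ?thesis using gibbs_pos[OF w] by (simp add: entropy_fun_def L right_diff_distrib)
      qed
      then show ?thesis
        by (simp add: sum_subtractf gibbs_sum flip: sum_distrib_right)
    qed
    finally have "ln (partition_sum N) \<le> (\<Sum>w\<in>lang N. gibbs N w * (ln (phi w) - ln (g w))) + s * ln (card I)"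
      by (simp add: ln_realpow sum_subtractf right_diff_distrib)
    also have "(\<Sum>w\<in>lang N. gibbs N w * (ln (phi w) - ln (g w)))
      \<le> (\<Sum>w\<in>lang N. gibbs N w * ((\<Sum>r<R. th (block N (j + r * q) w q)) + (D * real (s + 2) + C)))"
    proof (intro sum_mono mult_left_mono)
      fix w assume w: "w \<in> lang N"
      then have wI: "set w \<subseteq> I" "length w = j + (R * q + s')"
        using lang_subset_words s' by (auto simp: words_def)
      have "ln (g w) = (\<Sum>r<R. ln (empirical N (block N (j + r * q) w q)))"
        unfolding g[OF w]
      proof (rule ln_prod)
        show "empirical N (block N (j + r * q) w q) \<noteq> 0" if "r \<in> {..<R}" for r
          using empirical_block_pos[OF w blk(2)[OF w, of r], of q] that by simp
      qed simp
      moreover have "ln (phi w) \<le> (\<Sum>r<R. ln (phi (block N (j + r * q) w q)) + C) + D * real (s + 2) + C"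
        using phi_blocks_le[OF D(2) wI] blk(1)[OF w] s'(2) by simp
      ultimately show "ln (phi w) - ln (g w) \<le> (\<Sum>r<R. th (block N (j + r * q) w q)) + (D * real (s + 2) + C)"
        by (simp add: th_def sum_subtractf)
      show "0 \<le> gibbs N w" using gibbs_pos[OF w] by simp
    qed
    also have "\<dots> = (\<Sum>r<R. Th (j + r * q)) + (D * real (s + 2) + C)"
      unfolding Th_def
      by (simp add: distrib_left sum.distrib gibbs_sum sum_distrib_left flip: sum_distrib_right)
        (rule sum.swap)
    finally show ?thesis by (simp add: F_def)
  qed
  have "real q * ln (partition_sum N) = (\<Sum>j<q. ln (partition_sum N))" by simp
  also have "\<dots> \<le> (\<Sum>j<q. (\<Sum>r<R. Th (j + r * q)) + F)" by (intro sum_mono offset) auto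
  also have "\<dots> = (\<Sum>k<R * q. Th k) + q * F"
    by (simp add: sum.distrib sum_blocks_mod)
  \<comment> \<open>Passing to all positions below \<open>N\<close> adds \<open>s\<close> terms, none smaller than \<open>- B\<close>.\<close>
  also have "(\<Sum>k<R * q. Th k) \<le> (\<Sum>k<N. Th k) + s * B"
  proof -
    have low: "- B \<le> Th k" if "k < N" for k
    proof -
      have "- B = (\<Sum>w\<in>lang N. gibbs N w * (- B))"
        unfolding sum_distrib_right[symmetric] gibbs_sum by simp
      also have "\<dots> \<le> Th k" unfolding Th_def
      proof (intro sum_mono mult_left_mono)
        fix w assume w: "w \<in> lang N"
        have "block N k w q \<in> words I q" using block_lang[OF w] lang_subset_words by blast
        then have "- c * real (q + 1) \<le> ln (phi (block N k w q))"
          using phi_lower[of "block N k w q"] by (simp add: words_def)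
        moreover have "ln (empirical N (block N k w q)) \<le> 0"
          using empirical_block_pos[OF w that, of q] empirical_le_1[OF N1] by simp
        ultimately show "- B \<le> th (block N k w q)" by (simp add: th_def B_def)
        show "0 \<le> gibbs N w" using gibbs_pos[OF w] by simp
      qed
      finally show ?thesis .
    qed
    have "(\<Sum>k<N. Th k) = (\<Sum>k<R * q. Th k) + (\<Sum>k=R*q..<N. Th k)"
      using sum.atLeastLessThan_concat[of 0 "R*q" N Th] N by (simp add: atLeast0LessThan)
    moreover have "(\<Sum>k=R*q..<N. - B) \<le> (\<Sum>k=R*q..<N. Th k)" by (intro sum_mono low) auto
    ultimately show ?thesis using N by simp
  qed
  also have "(\<Sum>k<N. Th k) = N * (block_entropy q (empirical N) + block_energy q (empirical N) + C)"
  proof -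
    have "(\<Sum>k<N. Th k) = N * (\<Sum>v\<in>words I q. empirical N v * th v)"
      unfolding Th_def by (rule empirical_expectation[OF N1, symmetric])
    also have "(\<Sum>v\<in>words I q. empirical N v * th v) = block_energy q (empirical N) + C * (\<Sum>v\<in>words I q. empirical N v) + block_entropy q (empirical N)"
      unfolding block_energy_def block_entropy_def sum_distrib_left sum.distrib[symmetric]
      by (intro sum.cong refl) (auto simp: th_def entropy_fun_def algebra_simps)
    finally show ?thesis by (simp add: empirical_sum_words[OF N1] algebra_simps)
  qed
  finally show ?thesis by (simp add: F_def B_def)
qed

lemma empirical_inequality:
  assumes q: "q \<ge> 1"
  obtains G where "\<And>N. N \<ge> q \<Longrightarrow> real q * ln (partition_sum N) \<le> real N * (block_entropy q (empirical N) + block_energy q (empirical N) + C) + G"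
proof -
  obtain D where D: "0 \<le> D" "\<And>w. set w \<subseteq> I \<Longrightarrow> ln (phi w) \<le> D * real (length w + 1)"
    using phi_upper by blast
  have cI: "0 \<le> ln (real (card I))"
  proof -
    have "I \<noteq> {}" using K_nonempty K_letters by blast
    then show ?thesis using finite_I by (simp add: Suc_leI card_gt_0_iff)
  qed
  define B where "B = \<bar>c * real (q + 1) - C\<bar>"
  define G where "G = real (2 * q) * B + real q * (D * real (2 * q + 2) + C + real (2 * q) * ln (card I))"
  show ?thesis
  proof (rule that)
    fix N assume Nq: "N \<ge> q"
    \<comment> \<open>One block fewer than fits leaves room for every offset \<open>j < q\<close>.\<close>
    define R where "R = N div q - 1"
    define s where "s = N - R * q"
    have "N div q \<ge> 1" using Nq q by (simp add: Suc_le_eq div_greater_zero_iff)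
    then have "R * q + q = N div q * q" by (simp add: R_def algebra_simps)
    moreover have "N = N div q * q + N mod q" "N mod q < q" using q by simp_all
    ultimately have s: "N = R * q + s" "q \<le> s" "s \<le> 2 * q" unfolding s_def by linarith+
    have "real s * B + real q * (D * real (s + 2) + C + real s * ln (card I)) \<le> G"
      unfolding G_def using s(3) cI D(1)
      by (intro add_mono mult_mono mult_left_mono order_refl) (auto simp: B_def)
    then show "real q * ln (partition_sum N) \<le> real N * (block_entropy q (empirical N) + block_energy q (empirical N) + C) + G"
      using empirical_finite_inequality[OF D q s(1,2)] by (simp add: B_def)
  qed
qed

end

section \<open>Extreme maximising masses\<close>

text \<open>A cluster point described by a filter, along which all limits of the sequence are taken; the
  function space below need not be metrizable when the alphabet type is uncountable.\<close>

lemma compact_cluster_filter: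
  assumes "compact X" and x: "\<And>n::nat. x n \<in> X"
  obtains l \<Phi> where "l \<in> X" "\<Phi> \<noteq> bot" "\<Phi> \<le> sequentially" "(x \<longlongrightarrow> l) \<Phi>"
proof -
  have "filtermap x sequentially \<noteq> bot" by (simp add: filtermap_bot_iff)
  moreover have "eventually (\<lambda>y. y \<in> X) (filtermap x sequentially)"
    using x by (simp add: eventually_filtermap)
  ultimately obtain l where l: "l \<in> X" "inf (nhds l) (filtermap x sequentially) \<noteq> bot"
    using \<open>compact X\<close> unfolding compact_filter by blast
  define \<Phi> where "\<Phi> = inf (filtercomap x (nhds l)) sequentially"
  have "\<Phi> \<noteq> bot"
  proof
    assume "\<Phi> = bot"
    then have "eventually (\<lambda>_. False) \<Phi>" by simp
    then obtain Q R where QR: "eventually Q (filtercomap x (nhds l))" "eventually R sequentially"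
      "\<And>n. Q n \<Longrightarrow> R n \<Longrightarrow> False"
      unfolding \<Phi>_def eventually_inf by blast
    then obtain S where S: "eventually S (nhds l)" "\<And>n. S (x n) \<Longrightarrow> Q n"
      unfolding eventually_filtercomap by blast
    have "eventually (\<lambda>y. \<exists>n. y = x n \<and> R n) (filtermap x sequentially)"
      unfolding eventually_filtermap using QR(2) by eventually_elim blast
    then have "eventually (\<lambda>_. False) (inf (nhds l) (filtermap x sequentially))"
      unfolding eventually_inf using S QR(3) by blast
    then show False using l(2) by (simp add: trivial_limit_def)
  qed
  moreover have "\<Phi> \<le> sequentially" by (simp add: \<Phi>_def)
  moreover have "(x \<longlongrightarrow> l) \<Phi>"
    unfolding filterlim_iff_le_filtercomap \<Phi>_def by simp
  ultimately show ?thesis using l(1) that by blast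
qed

lemma compact_unit_functions: "compact {m :: 'a \<Rightarrow> real. \<forall>w. m w \<in> {0..1}}"
proof -
  have "compactin (product_topology (\<lambda>_. euclidean) UNIV) (PiE UNIV (\<lambda>_::'a. {0..1::real}))"
    unfolding compactin_PiE by simp
  moreover have "PiE UNIV (\<lambda>_::'a. {0..1::real}) = {m. \<forall>w. m w \<in> {0..1}}"
    by (auto simp: PiE_def)
  ultimately show ?thesis by (simp add: euclidean_product_topology)
qed

lemma tendsto_coordinate: "(x \<longlongrightarrow> l) F \<Longrightarrow> ((\<lambda>n. x n v) \<longlongrightarrow> (l v :: real)) F"
  using continuous_on_tendsto_compose[OF continuous_on_product_coordinates[of v]] by fastforce

context weighted_subshift
begin

text \<open>Any cluster point of the empirical masses works: the defect of shift invariance and the error in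
  \<open>empirical_inequality\<close> vanish in the limit, and for fixed \<open>q\<close> block entropy and
  block energy are continuous.\<close>

lemma maximisers_nonempty: "maximisers \<noteq> {}"
proof -
  have "empirical (Suc N) \<in> {m. \<forall>w. m w \<in> {0..1}}" for N by (simp add: empirical_nonneg empirical_le_1)
  from compact_cluster_filter[OF compact_unit_functions, of "\<lambda>N. empirical (Suc N)", OF this]
  obtain m \<Phi> where \<Phi>: "\<Phi> \<noteq> bot" "\<Phi> \<le> sequentially" and lim: "((\<lambda>N. empirical (Suc N)) \<longlongrightarrow> m) \<Phi>"
    by blast
  have lim: "((\<lambda>N. empirical (Suc N) v) \<longlongrightarrow> m v) \<Phi>" for v by (rule tendsto_coordinate[OF lim])
  have seq: "(f \<longlongrightarrow> l) sequentially \<Longrightarrow> (f \<longlongrightarrow> l) \<Phi>" for f :: "nat \<Rightarrow> real" and l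
    using \<Phi>(2) by (rule tendsto_mono)
  have nonneg: "0 \<le> m v" for v
    by (rule tendsto_lowerbound[OF lim _ \<Phi>(1)]) (simp add: empirical_nonneg)
  have "m v = 0" if "v \<notin> lang (length v)" for v
    using tendsto_unique[OF \<Phi>(1) lim[of v]] by (simp add: empirical_off[OF that])
  moreover have "m [] = 1"
    using tendsto_unique[OF \<Phi>(1) lim[of "[]"]] by (simp add: empirical_Nil)
  moreover have "m v = (\<Sum>i\<in>I. m (v @ [i]))" for v
  proof (rule tendsto_unique[OF \<Phi>(1) lim])
    show "((\<lambda>N. empirical (Suc N) v) \<longlongrightarrow> (\<Sum>i\<in>I. m (v @ [i]))) \<Phi>"
      unfolding empirical_snoc[of _ v] by (intro tendsto_sum lim)
  qed
  moreover have "m v = (\<Sum>i\<in>I. m (i # v))" for v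
  proof -
    have "((\<lambda>N. 1 / real (Suc N)) \<longlongrightarrow> 0) \<Phi>"
      by (rule seq, rule LIMSEQ_Suc, rule lim_const_over_n)
    then have "((\<lambda>N. empirical (Suc N) v - (\<Sum>i\<in>I. empirical (Suc N) (i # v))) \<longlongrightarrow> 0) \<Phi>"
      by (rule Lim_null_comparison[rotated]) (use empirical_Cons[of "Suc _" v] in \<open>simp add: eventually_True\<close>)
    moreover have "((\<lambda>N. empirical (Suc N) v - (\<Sum>i\<in>I. empirical (Suc N) (i # v))) \<longlongrightarrow> m v - (\<Sum>i\<in>I. m (i # v))) \<Phi>"
      by (intro tendsto_diff tendsto_sum lim)
    ultimately show ?thesis using tendsto_unique[OF \<Phi>(1)] by fastforce
  qed
  ultimately have m: "m \<in> masses" using nonneg unfolding masses_def by blast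
  have "real q * pressure_limit \<le> block_entropy q m + block_energy q m + C" if q: "q \<ge> 1" for q
  proof -
    obtain G where G: "\<And>N. N \<ge> q \<Longrightarrow> real q * ln (partition_sum N) \<le> real N * (block_entropy q (empirical N) + block_energy q (empirical N) + C) + G"
      using empirical_inequality[OF q] by blast
    have "(\<lambda>N. ln (partition_sum (Suc N)) / real (Suc N)) \<longlonglongrightarrow> pressure_limit"
      using LIMSEQ_Suc[OF pressure_limit_tendsto] by simp
    then have 1: "((\<lambda>N. real q * (ln (partition_sum (Suc N)) / real (Suc N))) \<longlongrightarrow> real q * pressure_limit) \<Phi>"
      by (intro tendsto_mult_left seq)
    have "((\<lambda>N. entropy_fun (empirical (Suc N) w)) \<longlongrightarrow> entropy_fun (m w)) \<Phi>" for w
      by (rule continuous_on_tendsto_compose[OF continuous_on_entropy_fun lim]) (simp_all add: nonneg empirical_nonneg)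
    moreover have "((\<lambda>N. G / real (Suc N)) \<longlongrightarrow> 0) \<Phi>"
      by (rule seq, rule LIMSEQ_Suc, rule lim_const_over_n)
    ultimately have 2: "((\<lambda>N. block_entropy q (empirical (Suc N)) + block_energy q (empirical (Suc N)) + C + G / real (Suc N)) \<longlongrightarrow> block_entropy q m + block_energy q m + C + 0) \<Phi>"
      unfolding block_entropy_def block_energy_def by (intro tendsto_add tendsto_sum tendsto_mult_right tendsto_const lim)
    have "eventually (\<lambda>N. q \<le> N) \<Phi>"
      using \<Phi>(2) eventually_ge_at_top[of q] unfolding le_filter_def by blast
    then have "eventually (\<lambda>N. real q * (ln (partition_sum (Suc N)) / real (Suc N))
        \<le> block_entropy q (empirical (Suc N)) + block_energy q (empirical (Suc N)) + C + G / real (Suc N)) \<Phi>"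
    proof eventually_elim
      case (elim N)
      then have "real q * ln (partition_sum (Suc N)) / real (Suc N)
          \<le> (real (Suc N) * (block_entropy q (empirical (Suc N)) + block_energy q (empirical (Suc N)) + C) + G) / real (Suc N)"
        by (intro divide_right_mono G) auto
      then show ?case by (simp add: add_divide_distrib del: of_nat_Suc)
    qed
    from tendsto_le[OF \<Phi>(1) 2 1 this] show ?thesis by simp
  qed
  with m have "m \<in> maximisers" by (simp add: maximisers_def)
  then show ?thesis by blast
qed

lemma maximisers_compact: "compact maximisers"
proof -
  let ?X = "{m :: 'i list \<Rightarrow> real. \<forall>w. m w \<in> {0..1}}"
  \<comment> \<open>Continuity of \<open>entropy_fun\<close> is used on the nonnegative reals; composing with \<open>max 0\<close> extends it to the whole space.\<close>
  let ?A = "{m :: 'i list \<Rightarrow> real. (\<forall>w. 0 \<le> m w) \<and> (\<forall>w. w \<notin> lang (length w) \<longrightarrow> m w = 0) \<and> m [] = 1 \<and>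
     (\<forall>w. m w = (\<Sum>i\<in>I. m (w @ [i]))) \<and> (\<forall>w. m w = (\<Sum>i\<in>I. m (i # w))) \<and>
     (\<forall>q. 1 \<le> q \<longrightarrow> real q * pressure_limit \<le> (\<Sum>w\<in>words I q. entropy_fun (max 0 (m w))) + block_energy q m + C)}"
  have "continuous_on UNIV (\<lambda>m :: 'i list \<Rightarrow> real. entropy_fun (max 0 (m w)))" for w
    by (rule continuous_on_compose2[OF continuous_on_entropy_fun]) (auto intro!: continuous_intros)
  then have "closed ?A"
    unfolding block_energy_def
    by (intro closed_Collect_conj closed_Collect_all closed_Collect_imp closed_Collect_le closed_Collect_eq
        open_Collect_const continuous_intros) auto
  moreover have "maximisers = ?X \<inter> ?A"
  proof -
    have A: "m \<in> ?A \<longleftrightarrow> m \<in> masses \<and>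
        (\<forall>q. 1 \<le> q \<longrightarrow> real q * pressure_limit \<le> (\<Sum>w\<in>words I q. entropy_fun (max 0 (m w))) + block_energy q m + C)" for m
      unfolding masses_def mem_Collect_eq by (simp only: conj_assoc)
    have block_entropy: "(\<Sum>w\<in>words I q. entropy_fun (max 0 (m w))) = block_entropy q m" if "m \<in> masses" for m q
      unfolding block_entropy_def by (intro sum.cong refl) (simp add: max_absorb2 m_nonneg that)
    have "masses \<subseteq> ?X" by (auto simp: m_nonneg m_le_1)
    then show ?thesis
      unfolding maximisers_def set_eq_iff Int_iff A using block_entropy by auto
  qed
  ultimately show ?thesis using compact_Int_closed[OF compact_unit_functions] by simp
qed

text \<open>Extreme points of the convex set \<open>masses\<close>: quantifying over all \<open>p\<close> in
  \<open>(0, 1)\<close>, it is enough to name one of the two components, since the combination then determines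
  the other.\<close>

definition extreme_mass :: "('i list \<Rightarrow> real) \<Rightarrow> bool" where
  "extreme_mass m \<longleftrightarrow> (\<forall>p n1 n2. 0 < p \<longrightarrow> p < 1 \<longrightarrow> n1 \<in> masses \<longrightarrow> n2 \<in> masses \<longrightarrow>
     m = (\<lambda>w. p * n1 w + (1 - p) * n2 w) \<longrightarrow> n1 = m)"

text \<open>A maximiser of a strictly convex function on a compact face is an extreme point. The function is
  the sum of \<open>2\<^sup>-\<^sup>k m(w\<^sub>k)\<^sup>2\<close> over an enumeration
  \<open>w\<^sub>k\<close> of all words; equality of its values forces equality of both components on every
  word.\<close>

lemma extreme_maximiser: "\<exists>m\<in>maximisers. extreme_mass m"
proof -
  define en where "en = from_nat_into (lists I)"
  have countable: "countable (lists I)" using finite_I by (intro countable_lists countable_finite)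
  then have en: "\<exists>k. en k = w" if "set w \<subseteq> I" for w
    using from_nat_into_to_nat_on[OF countable, of w] that unfolding en_def lists_eq_set by blast
  define G where "G m = (\<Sum>k. (1/2) ^ k * (m (en k))\<^sup>2)" for m :: "'i list \<Rightarrow> real"
  let ?X = "{m :: 'i list \<Rightarrow> real. \<forall>w. \<bar>m w\<bar> \<le> 1}"
  have sq: "\<bar>(1/2) ^ k * (m (en k))\<^sup>2\<bar> \<le> (1/2) ^ k" if "m \<in> ?X" for m k
    using that by (simp add: abs_mult power_le_one_iff abs_square_le_1)
  have summable: "summable (\<lambda>k. (1/2) ^ k * (m (en k))\<^sup>2)" if "m \<in> ?X" for m
    using sq[OF that] by (intro summable_comparison_test'[OF summable_geometric[of "1/2"]]) auto
  have "uniform_limit ?X (\<lambda>n m. \<Sum>k<n. (1/2) ^ k * (m (en k))\<^sup>2) G sequentially"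
    unfolding G_def
    using sq by (intro Weierstrass_m_test[OF _ summable_geometric[of "1/2"]]) auto
  then have "continuous_on ?X G"
    by (rule uniform_limit_theorem[rotated]) (auto intro!: always_eventually continuous_intros continuous_on_subset[OF continuous_on_product_coordinates])
  moreover have masses_X: "masses \<subseteq> ?X" by (auto simp: m_nonneg m_le_1)
  moreover have max_masses: "maximisers \<subseteq> masses" by (auto simp: maximisers_def)
  ultimately obtain m where m: "m \<in> maximisers" "\<And>n. n \<in> maximisers \<Longrightarrow> G n \<le> G m"
    using continuous_attains_sup[OF maximisers_compact maximisers_nonempty, of G]
    by (meson continuous_on_subset order_trans)
  show ?thesis
    unfolding extreme_mass_def
  proof (intro bexI[OF _ m(1)] allI impI)
    fix p n1 n2 assume p: "0 < p" "p < 1" and n: "n1 \<in> masses" "n2 \<in> masses"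
      and eq: "m = (\<lambda>w. p * n1 w + (1 - p) * n2 w)"
    have nmax: "n1 \<in> maximisers" "n2 \<in> maximisers"
      using maximisers_face[OF _ p n] m(1) unfolding eq by blast+
    define d where "d k = (1/2) ^ k * (n1 (en k) - n2 (en k))\<^sup>2" for k :: nat
    have X: "m \<in> ?X" "n1 \<in> ?X" "n2 \<in> ?X" using m(1) n masses_X max_masses by blast+
    \<comment> \<open>The defect of convexity of the square.\<close>
    have dk: "p * (1 - p) * d k = p * ((1/2) ^ k * (n1 (en k))\<^sup>2) + (1 - p) * ((1/2) ^ k * (n2 (en k))\<^sup>2)
        - (1/2) ^ k * (m (en k))\<^sup>2" for k
      by (simp add: d_def eq power2_eq_square algebra_simps)
    have sums: "(\<lambda>k. p * (1 - p) * d k) sums (p * G n1 + (1 - p) * G n2 - G m)"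
      unfolding dk G_def by (intro sums_diff sums_add sums_mult summable_sums summable X)
    note s = sums_summable[OF sums]
    have "(\<Sum>k. p * (1 - p) * d k) = p * G n1 + (1 - p) * G n2 - G m"
      using sums by (rule sums_unique[symmetric])
    also have "\<dots> \<le> p * G m + (1 - p) * G m - G m"
      using p m(2)[OF nmax(1)] m(2)[OF nmax(2)] by (intro diff_right_mono add_mono mult_left_mono) auto
    also have "\<dots> = 0" by (simp add: algebra_simps)
    finally have le: "(\<Sum>k. p * (1 - p) * d k) \<le> 0" .
    have d0: "0 \<le> p * (1 - p) * d k" for k using p by (simp add: d_def)
    have "(\<Sum>k. p * (1 - p) * d k) = 0" using le suminf_nonneg[OF s d0] by simp
    then have "p * (1 - p) * d k = 0" for k using suminf_eq_zero_iff[OF s d0] by blast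
    then have en_eq: "n1 (en k) = n2 (en k)" for k using p by (simp add: d_def)
    have "n1 w = n2 w" for w
    proof (cases "set w \<subseteq> I")
      case True
      then show ?thesis using en en_eq by metis
    next
      case False
      then have "w \<notin> lang (length w)" using lang_subset_words[of "length w"] by (auto simp: words_def)
      then show ?thesis using m_off[OF n(1)] m_off[OF n(2)] by simp
    qed
    then show "n1 = m" by (simp add: eq fun_eq_iff algebra_simps)
  qed
qed

end

section \<open>Cylinders and Borel sets\<close>

lemma topspace_seq_top: "topspace (seq_top I) = {x. \<forall>n. x n \<in> I}"
  by (auto simp: seq_top_def PiE_def Pi_def)

lemma cylinder_iff: "x \<in> cylinder I w \<longleftrightarrow> (\<forall>n. x n \<in> I) \<and> init_word (length w) x = w"
  by (simp add: cylinder_def topspace_seq_top)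

lemma cylinder_Nil: "cylinder I [] = topspace (seq_top I)"
  by (auto simp: cylinder_def)

lemma cylinder_eq_empty: "\<not> set w \<subseteq> I \<Longrightarrow> cylinder I w = {}"
  by (auto simp: cylinder_iff init_word_def) (metis atLeastLessThan_iff imageE list.set_map set_upt)

lemma cylinder_snoc: "cylinder I w = (\<Union>i\<in>I. cylinder I (w @ [i]))"
  by (auto simp: cylinder_iff init_word_Suc)

lemma left_shift_vimage_cylinder:
  "left_shift -` cylinder I w \<inter> topspace (seq_top I) = (\<Union>i\<in>I. cylinder I (i # w))"
proof (rule set_eqI)
  fix x
  have "x \<in> left_shift -` cylinder I w \<inter> topspace (seq_top I)
      \<longleftrightarrow> (\<forall>n. x n \<in> I) \<and> init_word (length w) (left_shift x) = w"
    unfolding cylinder_iff topspace_seq_top vimage_eq Int_iff mem_Collect_eq left_shift_def by blast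
  also have "\<dots> \<longleftrightarrow> x \<in> (\<Union>i\<in>I. cylinder I (i # w))"
    unfolding UN_iff cylinder_iff list.size add_0_right add_Suc_right init_word_Suc_Cons list.inject
    by (intro iffI; (elim conjE bexE)?; (intro bexI[of _ "x 0"] conjI)?) auto
  finally show "x \<in> left_shift -` cylinder I w \<inter> topspace (seq_top I) \<longleftrightarrow> x \<in> (\<Union>i\<in>I. cylinder I (i # w))" .
qed

lemma openin_cylinder: "openin (seq_top I) (cylinder I w)"
proof -
  have "cylinder I w = PiE UNIV (\<lambda>n. if n < length w then {w ! n} \<inter> I else I)"
  proof (rule set_eqI)
    fix x
    have "init_word (length w) x = w \<longleftrightarrow> (\<forall>n<length w. x n = w ! n)"
      unfolding init_word_def list_eq_iff_nth_eq by simp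
    then have "x \<in> cylinder I w \<longleftrightarrow> (\<forall>n. x n \<in> I) \<and> (\<forall>n<length w. x n = w ! n)"
      by (simp only: cylinder_iff)
    also have "\<dots> \<longleftrightarrow> (\<forall>n. x n \<in> (if n < length w then {w ! n} \<inter> I else I))"
      unfolding all_conj_distrib[symmetric] by (intro all_cong1) auto
    finally show "x \<in> cylinder I w \<longleftrightarrow> x \<in> PiE UNIV (\<lambda>n. if n < length w then {w ! n} \<inter> I else I)"
      by (simp only: PiE_UNIV_domain Pi_iff UNIV_I simp_thms ball_UNIV)
  qed
  moreover have "openin (seq_top I) \<dots>"
    unfolding seq_top_def
  proof (rule product_topology_basis)
    show "openin (discrete_topology I) (if n < length w then {w ! n} \<inter> I else I)" for n
      by simp
    show "finite {n. (if n < length w then {w ! n} \<inter> I else I) \<noteq> topspace (discrete_topology I)}"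
      by (rule finite_subset[of _ "{..<length w}"]) auto
  qed
  ultimately show ?thesis by simp
qed

lemma open_contains_cylinder:
  assumes "openin (seq_top I) U" "x \<in> U"
  obtains n where "cylinder I (init_word n x) \<subseteq> U"
proof -
  obtain V where V: "finite {i \<in> UNIV. V i \<noteq> topspace (discrete_topology I)}" "x \<in> PiE UNIV V" "PiE UNIV V \<subseteq> U"
    using assms unfolding seq_top_def openin_product_topology_alt by blast
  obtain n where n: "\<And>i. V i \<noteq> I \<Longrightarrow> i < n"
    using finite_nat_set_iff_bounded[THEN iffD1, OF V(1)] by auto
  have "cylinder I (init_word n x) \<subseteq> PiE UNIV V"
  proof
    fix y assume y: "y \<in> cylinder I (init_word n x)"
    have "y i \<in> V i" for i
    proof (cases "V i = I")
      case True
      then show ?thesis using y by (simp add: cylinder_iff)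
    next
      case False
      then have "y i = x i" using n[of i] y by (simp add: cylinder_iff init_word_def)
      then show ?thesis using V(2) by auto
    qed
    then show "y \<in> PiE UNIV V" by (simp add: PiE_iff)
  qed
  then have "cylinder I (init_word n x) \<subseteq> U" using V(3) by (rule order_trans)
  then show ?thesis by (rule that)
qed

lemma space_seq_borel: "space (seq_borel I) = topspace (seq_top I)"
  unfolding seq_borel_def by (rule space_measure_of) (auto dest: openin_subset)

lemma sets_seq_borel_eq: "sets (seq_borel I) = sigma_sets (topspace (seq_top I)) {U. openin (seq_top I) U}"
  unfolding seq_borel_def by (rule sets_measure_of) (auto dest: openin_subset)

lemma open_in_sets: "openin (seq_top I) U \<Longrightarrow> U \<in> sets (seq_borel I)"
  unfolding sets_seq_borel_eq by auto

lemma cylinder_in_sets: "cylinder I w \<in> sets (seq_borel I)"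
  by (intro open_in_sets openin_cylinder)

text \<open>Every open set is a union of cylinders, and there are only countably many of these.\<close>

lemma sets_seq_borel_cylinders:
  assumes "finite I"
  shows "sets (seq_borel I) = sigma_sets (topspace (seq_top I)) (range (cylinder I))"
proof
  show "sigma_sets (topspace (seq_top I)) (range (cylinder I)) \<subseteq> sets (seq_borel I)"
    using sets.sigma_sets_subset[of "range (cylinder I)" "seq_borel I"] cylinder_in_sets
    by (auto simp: space_seq_borel)
  show "sets (seq_borel I) \<subseteq> sigma_sets (topspace (seq_top I)) (range (cylinder I))"
    unfolding sets_seq_borel_eq
  proof (rule sigma_sets_mono, rule subsetI, clarify)
    fix U assume U: "openin (seq_top I) U"
    define W where "W = {w \<in> lists I. cylinder I w \<subseteq> U}"
    have "countable (lists I)" using assms by (intro countable_lists countable_finite)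
    then have W: "countable W" unfolding W_def by (rule countable_subset[rotated]) auto
    have "x \<in> (\<Union>w\<in>W. cylinder I w)" if xU: "x \<in> U" for x
    proof -
      have xI: "\<forall>n. x n \<in> I" using openin_subset[OF U] xU by (auto simp: topspace_seq_top)
      obtain n where "cylinder I (init_word n x) \<subseteq> U" using open_contains_cylinder[OF U xU] .
      moreover have "init_word n x \<in> lists I" "x \<in> cylinder I (init_word n x)"
        using xI by (auto simp: cylinder_iff init_word_def)
      ultimately show ?thesis by (auto simp: W_def)
    qed
    then have "U = (\<Union>w\<in>W. cylinder I w)" by (auto simp: W_def)
    moreover have "\<dots> \<in> sigma_sets (topspace (seq_top I)) (range (cylinder I))"
      using W by (intro sigma_sets_UNION) auto
    ultimately show "U \<in> sigma_sets (topspace (seq_top I)) (range (cylinder I))" by simp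
  qed
qed

lemma cylinder_Int_stable: "Int_stable (insert {} (range (cylinder I)))"
proof -
  have *: "cylinder I u \<inter> cylinder I v \<in> {cylinder I v, {}}" if le: "length u \<le> length v" for u v
  proof (cases "take (length u) v = u")
    case True
    have "cylinder I v \<subseteq> cylinder I u"
    proof
      fix x assume x: "x \<in> cylinder I v"
      then have "take (length u) (init_word (length v) x) = u" using True by (simp add: cylinder_iff)
      then have "init_word (length u) x = u" using le by (simp add: init_word_def take_map)
      then show "x \<in> cylinder I u" using x by (simp add: cylinder_iff)
    qed
    then show ?thesis by auto
  next
    case False
    have "x \<notin> cylinder I u \<inter> cylinder I v" for x
    proof
      assume "x \<in> cylinder I u \<inter> cylinder I v"
      then have "init_word (length u) x = u" "init_word (length v) x = v" by (simp_all add: cylinder_iff)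
      moreover have "take (length u) (init_word (length v) x) = init_word (length u) x"
        using le by (simp add: init_word_def take_map)
      ultimately show False using False by simp
    qed
    then show ?thesis by blast
  qed
  show ?thesis
    unfolding Int_stable_def
  proof (intro ballI)
    fix a b assume "a \<in> insert {} (range (cylinder I))" "b \<in> insert {} (range (cylinder I))"
    then consider "a = {} \<or> b = {}" | u v where "a = cylinder I u" "b = cylinder I v" by blast
    then show "a \<inter> b \<in> insert {} (range (cylinder I))"
    proof cases
      case (2 u v)
      then show ?thesis
        using *[of u v] *[of v u] nat_le_linear[of "length u" "length v"] by (auto simp: Int_commute)
    qed auto
  qed
qed

text \<open>Two cylinders are nested or disjoint, so together with the empty set they form a generator closed
  under intersection.\<close>

lemma measure_eqI_cylinders:
  assumes I: "finite I" and M: "finite_measure M" and sets: "sets M = sets (seq_borel I)" "sets N = sets (seq_borel I)"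
    and eq: "\<And>w. emeasure M (cylinder I w) = emeasure N (cylinder I w)"
  shows "M = N"
proof (rule measure_eqI_generator_eq[OF cylinder_Int_stable[of I], where A = "\<lambda>_. topspace (seq_top I)"])
  have s: "sigma_sets (topspace (seq_top I)) (insert {} (range (cylinder I))) = sets (seq_borel I)"
    unfolding sets_seq_borel_cylinders[OF I]
    by (intro sigma_sets_eqI) (auto intro: sigma_sets.Empty)
  show "sets M = sigma_sets (topspace (seq_top I)) (insert {} (range (cylinder I)))"
    "sets N = sigma_sets (topspace (seq_top I)) (insert {} (range (cylinder I)))"
    by (simp_all add: s sets)
  show "insert {} (range (cylinder I)) \<subseteq> Pow (topspace (seq_top I))"
    by (auto simp: cylinder_def)
  show "emeasure M (topspace (seq_top I)) \<noteq> \<infinity>"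
    using finite_measure.emeasure_finite[OF M] by simp
  show "range (\<lambda>_. topspace (seq_top I)) \<subseteq> insert {} (range (cylinder I))"
    by (auto simp flip: cylinder_Nil)
qed (use eq in auto)

lemma measurable_seq_borel:
  assumes "finite I" "f \<in> space M \<rightarrow> topspace (seq_top I)"
    and "\<And>w. f -` cylinder I w \<inter> space M \<in> sets M"
  shows "f \<in> measurable M (seq_borel I)"
  by (rule measurable_sigma_sets[OF sets_seq_borel_cylinders[OF assms(1)]])
    (use assms in \<open>auto simp: cylinder_def\<close>)

lemma measurable_left_shift:
  assumes "finite I" shows "left_shift \<in> measurable (seq_borel I) (seq_borel I)"
proof (rule measurable_seq_borel[OF assms])
  show "left_shift \<in> space (seq_borel I) \<rightarrow> topspace (seq_top I)"
    by (auto simp: space_seq_borel topspace_seq_top left_shift_def)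
  show "left_shift -` cylinder I w \<inter> space (seq_borel I) \<in> sets (seq_borel I)" for w
    unfolding space_seq_borel left_shift_vimage_cylinder
    using assms cylinder_in_sets by (intro sets.finite_UN) auto
qed

lemma measure_Int_UN_cylinders:
  assumes I: "finite I" and M: "finite_measure M" "sets M = sets (seq_borel I)" and B: "B \<in> sets M"
    and g: "inj_on g I" "\<And>i. length (g i) = n"
  shows "measure M ((\<Union>i\<in>I. cylinder I (g i)) \<inter> B) = (\<Sum>i\<in>I. measure M (cylinder I (g i) \<inter> B))"
proof -
  have "(\<Union>i\<in>I. cylinder I (g i)) \<inter> B = (\<Union>i\<in>I. cylinder I (g i) \<inter> B)" by blast
  moreover have "measure M (\<Union>i\<in>I. cylinder I (g i) \<inter> B) = (\<Sum>i\<in>I. measure M (cylinder I (g i) \<inter> B))"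
  proof (rule finite_measure.finite_measure_finite_Union[OF M(1) I])
    show "disjoint_family_on (\<lambda>i. cylinder I (g i) \<inter> B) I"
      unfolding disjoint_family_on_def
    proof (intro ballI impI)
      fix i j assume ij: "i \<in> I" "j \<in> I" "i \<noteq> j"
      then have "g i \<noteq> g j" using g(1) by (auto dest: inj_onD)
      then show "(cylinder I (g i) \<inter> B) \<inter> (cylinder I (g j) \<inter> B) = {}"
        using g(2) by (auto simp: cylinder_iff)
    qed
  qed (use B M(2) cylinder_in_sets in auto)
  ultimately show ?thesis by simp
qed

section \<open>Measures with prescribed cylinder masses\<close>

context
  fixes I :: "'i set" and m :: "'i list \<Rightarrow> real" and f :: "nat \<Rightarrow> 'i"
  assumes I: "finite I" and f: "bij_betw f {..<card I} I"
    and m_nonneg: "\<And>w. 0 \<le> m w" and m_Nil: "m [] = 1" and m_snoc: "\<And>w. m w = (\<Sum>i\<in>I. m (w @ [i]))"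
begin

definition letter_index :: "'i \<Rightarrow> nat" where "letter_index i = the_inv_into {..<card I} f i"

text \<open>The intervals \<open>code_interval w\<close> of the words \<open>w\<close> of a given length
  partition \<open>{0..<1}\<close> in lexicographic order, letters being ordered by the enumeration
  \<open>f\<close>: to the left of \<open>w\<close> lie the words that first differ from it by an earlier
  letter.\<close>

definition interval_left :: "'i list \<Rightarrow> real" where
  "interval_left w = (\<Sum>n<length w. \<Sum>k<letter_index (w ! n). m (take n w @ [f k]))"

definition code_interval :: "'i list \<Rightarrow> real set" where "code_interval w = {interval_left w..<interval_left w + m w}"

lemma letter_index: "i \<in> I \<Longrightarrow> letter_index i < card I" "i \<in> I \<Longrightarrow> f (letter_index i) = i" "k < card I \<Longrightarrow> letter_index (f k) = k"
  using f the_inv_into_into[of f "{..<card I}" i] f_the_inv_into_f_bij_betw[OF f] the_inv_into_f_f[of f "{..<card I}" k]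
  unfolding letter_index_def bij_betw_def by auto

lemma interval_left_snoc: "interval_left (w @ [i]) = interval_left w + (\<Sum>k<letter_index i. m (w @ [f k]))"
  unfolding interval_left_def by (simp add: nth_append)

lemma code_interval_snoc_f: "k < card I \<Longrightarrow>
   code_interval (w @ [f k]) = {interval_left w + (\<Sum>j<k. m (w @ [f j]))..<interval_left w + (\<Sum>j<Suc k. m (w @ [f j]))}"
  by (simp add: code_interval_def interval_left_snoc letter_index(3) add.assoc)

lemma m_eq_sum_f: "m w = (\<Sum>k<card I. m (w @ [f k]))"
  using m_snoc[of w] sum.reindex_bij_betw[OF f, of "\<lambda>i. m (w @ [i])"] by simp

lemma code_interval_snoc_subset: "i \<in> I \<Longrightarrow> code_interval (w @ [i]) \<subseteq> code_interval w"
proof -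
  assume i: "i \<in> I"
  have "(\<Sum>j<Suc (letter_index i). m (w @ [f j])) \<le> (\<Sum>k<card I. m (w @ [f k]))"
    by (rule sum_mono2) (use letter_index(1)[OF i] m_nonneg in auto)
  moreover have "0 \<le> (\<Sum>j<letter_index i. m (w @ [f j]))" by (simp add: sum_nonneg m_nonneg)
  ultimately show ?thesis
    using code_interval_snoc_f[OF letter_index(1)[OF i], of w] letter_index(2)[OF i] m_eq_sum_f[of w] by (auto simp: code_interval_def)
qed

lemma code_interval_snoc_ex:
  assumes u: "u \<in> code_interval w" shows "\<exists>i\<in>I. u \<in> code_interval (w @ [i])"
proof -
  define S where "S k = interval_left w + (\<Sum>j<k. m (w @ [f j]))" for k
  have ex: "u < S (card I)" using u by (simp add: S_def code_interval_def flip: m_eq_sum_f)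
  define k where "k = (LEAST k. u < S k)"
  have k: "u < S k" unfolding k_def by (rule LeastI[of "\<lambda>k. u < S k", OF ex])
  have le: "k \<le> card I" unfolding k_def by (rule Least_le[of "\<lambda>k. u < S k", OF ex])
  have "S 0 \<le> u" using u by (simp add: S_def code_interval_def)
  then obtain l where l: "k = Suc l" using k by (cases k) auto
  have "S l \<le> u" using not_less_Least[of l "\<lambda>k. u < S k"] l k_def by simp
  then have "u \<in> code_interval (w @ [f l])" using k le l by (subst code_interval_snoc_f) (auto simp: S_def)
  moreover have "f l \<in> I" using f le l by (auto simp: bij_betw_def)
  ultimately show ?thesis by blast
qed

lemma code_interval_snoc_unique:
  assumes "i \<in> I" "i' \<in> I" "u \<in> code_interval (w @ [i])" "u \<in> code_interval (w @ [i'])" shows "i = i'"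
proof -
  define S where "S k = interval_left w + (\<Sum>j<k. m (w @ [f j]))" for k
  have mono: "S a \<le> S b" if "a \<le> b" for a b
    unfolding S_def using that by (intro add_left_mono sum_mono2) (auto simp: m_nonneg)
  have "u \<in> {S (letter_index i)..<S (Suc (letter_index i))}" "u \<in> {S (letter_index i')..<S (Suc (letter_index i'))}"
    using assms code_interval_snoc_f[OF letter_index(1), of i w] code_interval_snoc_f[OF letter_index(1), of i' w] letter_index(2)[of i] letter_index(2)[of i'] by (auto simp: S_def)
  then have "letter_index i = letter_index i'"
    using mono[of "Suc (letter_index i)" "letter_index i'"] mono[of "Suc (letter_index i')" "letter_index i"]
    by (cases "letter_index i" "letter_index i'" rule: linorder_cases) auto
  then show ?thesis using letter_index(2) assms by metis
qed

text \<open>The word of length \<open>n\<close> whose interval contains \<open>u\<close>, so that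
  \<open>code\<close> pulls a cylinder back to an interval of the prescribed length.\<close>

fun code_word :: "real \<Rightarrow> nat \<Rightarrow> 'i list" where
  "code_word u 0 = []"
| "code_word u (Suc n) = code_word u n @ [SOME i. i \<in> I \<and> u \<in> code_interval (code_word u n @ [i])]"

definition code :: "real \<Rightarrow> nat \<Rightarrow> 'i" where "code u n = last (code_word u (Suc n))"

lemma init_word_code: "init_word n (code u) = code_word u n"
  by (induction n) (simp_all add: init_word_Suc code_def)

lemma code_interval_Nil: "code_interval [] = {0..<1}" by (simp add: code_interval_def interval_left_def m_Nil)

lemma code_word:
  assumes u: "u \<in> {0..<1}"
  shows "u \<in> code_interval (code_word u n)" and "code u n \<in> I"
proof -
  have *: "u \<in> code_interval (code_word u n)" for n
  proof (induction n)
    case (Suc n)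
    show ?case using someI_ex[of "\<lambda>i. i \<in> I \<and> u \<in> code_interval (code_word u n @ [i])"] code_interval_snoc_ex[OF Suc] by auto
  qed (simp add: code_interval_Nil u[simplified])
  then show "u \<in> code_interval (code_word u n)" .
  show "code u n \<in> I"
    using someI_ex[of "\<lambda>i. i \<in> I \<and> u \<in> code_interval (code_word u n @ [i])"] code_interval_snoc_ex[OF *[of n]] by (auto simp: code_def)
qed

lemma code_word_unique: "set w \<subseteq> I \<Longrightarrow> u \<in> code_interval w \<Longrightarrow> u \<in> {0..<1} \<and> code_word u (length w) = w"
proof (induction w rule: rev_induct)
  case Nil
  then show ?case by (simp add: code_interval_Nil)
next
  case (snoc i w)
  have IH: "u \<in> {0..<1}" "code_word u (length w) = w"
    using snoc code_interval_snoc_subset[of i w] by auto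
  have "u \<in> code_interval (w @ [code u (length w)])"
    using code_word(1)[OF IH(1), of "Suc (length w)"] IH(2) by (simp add: code_def)
  then have "code u (length w) = i"
    by (rule code_interval_snoc_unique[rotated 2]) (use code_word(2)[OF IH(1)] snoc.prems in auto)
  then show ?case using IH by (simp add: code_def)
qed

lemma code_vimage_cylinder: "code -` cylinder I w \<inter> {0..<1} = (if set w \<subseteq> I then code_interval w else {})"
proof (cases "set w \<subseteq> I")
  case True
  have "u \<in> code -` cylinder I w \<inter> {0..<1} \<longleftrightarrow> u \<in> code_interval w" for u
    using code_word_unique[OF True, of u] code_word[of u "length w"] code_word(2)[of u]
    by (auto simp: cylinder_iff init_word_code)
  then have "code -` cylinder I w \<inter> {0..<1} = code_interval w" by (rule set_eqI)
  then show ?thesis using True by simp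
qed (simp add: cylinder_eq_empty)

definition mass_measure :: "(nat \<Rightarrow> 'i) measure" where
  "mass_measure = distr (restrict_space lborel {0..<1}) (seq_borel I) code"

lemma measurable_code: "code \<in> measurable (restrict_space lborel {0..<1}) (seq_borel I)"
proof (rule measurable_seq_borel[OF I])
  show "code \<in> space (restrict_space lborel {0..<1}) \<rightarrow> topspace (seq_top I)"
    using code_word(2) by (auto simp: space_restrict_space topspace_seq_top)
  show "code -` cylinder I w \<inter> space (restrict_space lborel {0..<1}) \<in> sets (restrict_space lborel {0..<1})" for w
  proof -
    have "code_interval w \<subseteq> {0..<1}" if "set w \<subseteq> I" using code_word_unique[OF that] by blast
    then show ?thesis
      by (auto simp: space_restrict_space code_vimage_cylinder sets_restrict_space_iff code_interval_def)
  qed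
qed

lemma emeasure_mass_measure:
  assumes "set w \<subseteq> I" shows "emeasure mass_measure (cylinder I w) = ennreal (m w)"
proof -
  have sub: "code_interval w \<subseteq> {0..<1}" using code_word_unique[OF assms] by blast
  have "emeasure mass_measure (cylinder I w) = emeasure (restrict_space lborel {0..<1}) (code_interval w)"
    unfolding mass_measure_def using code_vimage_cylinder[of w] assms
    by (subst emeasure_distr[OF measurable_code cylinder_in_sets]) (simp add: space_restrict_space)
  also have "\<dots> = emeasure lborel (code_interval w)" using sub by (subst emeasure_restrict_space) auto
  also have "\<dots> = ennreal (m w)" using m_nonneg by (simp add: code_interval_def)
  finally show ?thesis .
qed

lemma mass_measure_props: "sets mass_measure = sets (seq_borel I)" "prob_space mass_measure"
proof -
  show s: "sets mass_measure = sets (seq_borel I)" by (simp add: mass_measure_def)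
  have "space mass_measure = cylinder I []"
    using sets_eq_imp_space_eq[OF s] by (simp add: space_seq_borel cylinder_Nil)
  then show "prob_space mass_measure"
    using emeasure_mass_measure[of "[]"] m_Nil by (intro prob_spaceI) simp
qed

end

theorem cylinder_masses_extend:
  fixes I :: "'i set" and m :: "'i list \<Rightarrow> real"
  assumes "finite I" "\<And>w. 0 \<le> m w" "m [] = 1" "\<And>w. m w = (\<Sum>i\<in>I. m (w @ [i]))"
  obtains \<mu> where "prob_space \<mu>" "sets \<mu> = sets (seq_borel I)"
    "\<And>w. set w \<subseteq> I \<Longrightarrow> measure \<mu> (cylinder I w) = m w"
proof -
  obtain f where f: "bij_betw f {..<card I} I"
    using ex_bij_betw_nat_finite[OF assms(1)] by (auto simp: atLeast0LessThan)
  show ?thesis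
    using that[OF mass_measure_props(2,1)[OF assms(1) f assms(2-4)]]
      emeasure_mass_measure[OF assms(1) f assms(2-4)] assms(2) by (simp add: measure_def)
qed

section \<open>Ergodic equilibrium measures\<close>

text \<open>Compact subsets of the Hausdorff sequence space are closed, so some cylinder around
  \<open>x\<close> misses \<open>K\<close>.\<close>

lemma closed_init_words:
  assumes K: "compactin (seq_top I) K" and x: "x \<in> topspace (seq_top I)" "x \<notin> K"
  obtains n where "init_word n x \<notin> init_word n ` K"
proof -
  have "Hausdorff_space (seq_top I)"
    unfolding seq_top_def by (simp add: Hausdorff_space_product_topology Hausdorff_space_discrete_topology)
  then have "closedin (seq_top I) K" using K by (rule compactin_imp_closedin)
  then have "openin (seq_top I) (topspace (seq_top I) - K)" by blast
  then obtain n where n: "cylinder I (init_word n x) \<subseteq> topspace (seq_top I) - K"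
    using open_contains_cylinder[of I _ x] x by blast
  have "init_word n x \<notin> init_word n ` K"
  proof
    assume "init_word n x \<in> init_word n ` K"
    then obtain y where y: "y \<in> K" "init_word n x = init_word n y" by blast
    then have "y \<in> cylinder I (init_word n x)"
      using compactin_subset_topspace[OF K] by (auto simp: cylinder_def)
    then show False using n y(1) by blast
  qed
  then show ?thesis by (rule that)
qed

lemma shift_invariantI:
  assumes I: "finite I" and M: "finite_measure M" "sets M = sets (seq_borel I)"
    and cyl: "\<And>w. measure M (cylinder I w) = (\<Sum>i\<in>I. measure M (cylinder I (i # w)))"
    and B: "B \<in> sets M"
  shows "measure M (left_shift -` B \<inter> space M) = measure M B"
proof -
  interpret finite_measure M by (rule M)
  have sp: "space M = topspace (seq_top I)"
    using sets_eq_imp_space_eq[OF M(2)] by (simp add: space_seq_borel)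
  have meas: "left_shift \<in> measurable M M"
    using measurable_left_shift[OF I] measurable_cong_sets[OF M(2) M(2)] by blast
  have cs: "cylinder I w \<in> sets M" for w by (simp add: M(2) cylinder_in_sets)
  have "distr M M left_shift = M"
  proof (rule measure_eqI_cylinders[OF I])
    show "finite_measure (distr M M left_shift)" by (rule finite_measure_distr[OF meas])
    fix w
    have Int_space: "S \<inter> space M = S" if "S \<in> sets M" for S
      using sets.sets_into_space[OF that] by blast
    have UN: "(\<Union>i\<in>I. cylinder I (i # w)) \<in> sets M" using I cs by (intro sets.finite_UN) auto
    have "measure M (left_shift -` cylinder I w \<inter> space M) = measure M ((\<Union>i\<in>I. cylinder I (i # w)) \<inter> space M)"
      by (simp only: Int_space[OF UN]) (simp only: sp left_shift_vimage_cylinder)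
    also have "\<dots> = (\<Sum>i\<in>I. measure M (cylinder I (i # w) \<inter> space M))"
      by (rule measure_Int_UN_cylinders[OF I M sets.top]) (auto simp: inj_on_def)
    also have "\<dots> = measure M (cylinder I w)" by (simp only: Int_space[OF cs] cyl[symmetric])
    finally have "measure M (left_shift -` cylinder I w \<inter> space M) = measure M (cylinder I w)" .
    then show "emeasure (distr M M left_shift) (cylinder I w) = emeasure M (cylinder I w)"
      by (simp add: emeasure_distr[OF meas cs] emeasure_eq_measure)
  qed (simp_all add: M)
  then have "measure M B = measure (distr M M left_shift) B" by simp
  also have "\<dots> = measure M (left_shift -` B \<inter> space M)" by (rule measure_distr[OF meas B])
  finally show ?thesis ..
qed

context weighted_subshift
begin

context
  fixes \<mu> :: "(nat \<Rightarrow> 'i) measure" and m :: "'i list \<Rightarrow> real"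
  assumes prob: "prob_space \<mu>" and sets: "sets \<mu> = sets (seq_borel I)"
    and m: "m \<in> masses" and cyl: "\<And>w. measure \<mu> (cylinder I w) = m w"
begin

lemma space_\<mu>: "space \<mu> = topspace (seq_top I)"
  using sets_eq_imp_space_eq[OF sets] by (simp add: space_seq_borel)

lemma finite_\<mu>: "finite_measure \<mu>"
  using prob by (simp add: prob_space_def)

lemma cylinder_sets: "cylinder I w \<in> sets \<mu>"
  by (simp add: sets cylinder_in_sets)

lemma shift_invariant: "B \<in> sets \<mu> \<Longrightarrow> measure \<mu> (left_shift -` B \<inter> space \<mu>) = measure \<mu> B"
  by (rule shift_invariantI[OF finite_I finite_\<mu> sets]) (simp_all add: cyl m_Cons[OF m, symmetric])

lemma support_subset:
  assumes K: "compactin (seq_top I) K" shows "measure_support I \<mu> \<subseteq> K"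
proof
  fix x assume x: "x \<in> measure_support I \<mu>"
  show "x \<in> K"
  proof (rule ccontr)
    assume "x \<notin> K"
    moreover have xI: "x \<in> topspace (seq_top I)" using x by (simp add: measure_support_def)
    ultimately obtain n where "init_word n x \<notin> lang n"
      using closed_init_words[OF K] unfolding lang_def by blast
    then have "measure \<mu> (cylinder I (init_word n x)) = 0"
      using m_off[OF m, of "init_word n x"] by (simp add: cyl)
    moreover have "x \<in> cylinder I (init_word n x)" using xI by (simp add: cylinder_def)
    ultimately show False using x openin_cylinder[of I "init_word n x"] by (force simp: measure_support_def)
  qed
qed

lemma measure_entropy_eq_entropy_rate: "measure_entropy I \<mu> = entropy_rate m"
  by (simp add: measure_entropy_def entropy_rate_def block_entropy_def cyl divide_inverse mult.commute)

text \<open>Conditioning an invariant measure on an invariant set keeps it invariant and carried by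
  \<open>K\<close>.\<close>

lemma conditional_masses:
  assumes B: "B \<in> sets \<mu>" "left_shift -` B \<inter> space \<mu> = B" and p: "0 < measure \<mu> B"
  shows "(\<lambda>w. measure \<mu> (cylinder I w \<inter> B) / measure \<mu> B) \<in> masses"
proof -
  interpret finite_measure \<mu> by (rule finite_\<mu>)
  let ?n = "\<lambda>w. measure \<mu> (cylinder I w \<inter> B)"
  have Bsp: "B \<subseteq> topspace (seq_top I)" using sets.sets_into_space[OF B(1)] by (simp add: space_\<mu>)
  have snoc: "?n w = (\<Sum>i\<in>I. ?n (w @ [i]))" for w
    unfolding cylinder_snoc[of I w]
    by (rule measure_Int_UN_cylinders[OF finite_I finite_\<mu> sets B(1)]) (auto simp: inj_on_def)
  have Cons: "?n w = (\<Sum>i\<in>I. ?n (i # w))" for w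
  proof -
    have "?n w = measure \<mu> (left_shift -` (cylinder I w \<inter> B) \<inter> space \<mu>)"
      using shift_invariant[of "cylinder I w \<inter> B"] B(1) cylinder_sets by simp
    also have "left_shift -` (cylinder I w \<inter> B) \<inter> space \<mu> =
        (left_shift -` cylinder I w \<inter> topspace (seq_top I)) \<inter> (left_shift -` B \<inter> space \<mu>)"
      by (auto simp: space_\<mu>)
    also have "\<dots> = (\<Union>i\<in>I. cylinder I (i # w)) \<inter> B"
      by (simp only: left_shift_vimage_cylinder B(2))
    also have "measure \<mu> \<dots> = (\<Sum>i\<in>I. ?n (i # w))"
      by (rule measure_Int_UN_cylinders[OF finite_I finite_\<mu> sets B(1)]) (auto simp: inj_on_def)
    finally show ?thesis .
  qed
  have off: "?n w = 0" if "w \<notin> lang (length w)" for w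
  proof -
    have "?n w \<le> measure \<mu> (cylinder I w)" by (intro finite_measure_mono cylinder_sets) auto
    then show ?thesis using m_off[OF m that] by (simp add: cyl measure_le_0_iff)
  qed
  have Nil: "?n [] = measure \<mu> B" using Bsp by (simp add: cylinder_Nil Int_absorb1)
  show ?thesis
    unfolding masses_def mem_Collect_eq sum_divide_distrib[symmetric] snoc[symmetric] Cons[symmetric]
    using p off by (simp add: Nil)
qed

text \<open>An invariant set \<open>B\<close> of measure \<open>p\<close> splits the masses into a convex
  combination of two conditional masses. By extremality \<open>B\<close> is independent of every cylinder,
  hence of every Borel set, hence of itself, so \<open>p = p\<^sup>2\<close>.\<close>

lemma extreme_masses_ergodic:
  assumes ext: "extreme_mass m"
  shows "shift_ergodic \<mu>"
  unfolding shift_ergodic_def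
proof (intro ballI impI)
  interpret prob_space \<mu> by (rule prob)
  fix B assume B: "B \<in> sets \<mu>" "left_shift -` B \<inter> space \<mu> = B"
  define p where "p = measure \<mu> B"
  show "measure \<mu> B = 0 \<or> measure \<mu> B = 1"
  proof (rule ccontr)
    assume "\<not> ?thesis"
    then have p: "0 < p" "p < 1" using measure_nonneg[of \<mu> B] prob_le_1[of B] by (auto simp: p_def less_le)
    define B' where "B' = space \<mu> - B"
    have B': "B' \<in> sets \<mu>" using B by (simp add: B'_def)
    have shift_space: "left_shift x \<in> space \<mu>" if "x \<in> space \<mu>" for x
      using that by (simp add: space_\<mu> topspace_seq_top left_shift_def)
    have inv': "left_shift -` B' \<inter> space \<mu> = B'" using B(2) shift_space by (auto simp: B'_def)
    have p': "measure \<mu> B' = 1 - p" using B by (simp add: B'_def prob_compl p_def)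
    let ?n1 = "\<lambda>w. measure \<mu> (cylinder I w \<inter> B) / p"
    let ?n2 = "\<lambda>w. measure \<mu> (cylinder I w \<inter> B') / (1 - p)"
    have "?n1 = m"
    proof (rule ext[unfolded extreme_mass_def, rule_format, OF p])
      show "?n1 \<in> masses" using conditional_masses[OF B] p by (simp add: p_def)
      show "?n2 \<in> masses" using conditional_masses[OF B' inv'] p by (simp add: p')
      have "m w = measure \<mu> (cylinder I w \<inter> B) + measure \<mu> (cylinder I w \<inter> B')" for w
      proof -
        have "cylinder I w = (cylinder I w \<inter> B) \<union> (cylinder I w \<inter> B')"
          using sets.sets_into_space[OF cylinder_sets[of w]] by (auto simp: B'_def)
        moreover have "measure \<mu> \<dots> = measure \<mu> (cylinder I w \<inter> B) + measure \<mu> (cylinder I w \<inter> B')"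
          by (intro finite_measure_Union) (use B B' cylinder_sets in \<open>auto simp: B'_def\<close>)
        ultimately show ?thesis using cyl[of w] by simp
      qed
      then show "m = (\<lambda>w. p * ?n1 w + (1 - p) * ?n2 w)" using p by auto
    qed
    then have indep: "measure \<mu> (cylinder I w \<inter> B) = p * measure \<mu> (cylinder I w)" for w
      using p cyl[of w] by (auto simp: fun_eq_iff field_simps)
    have "density \<mu> (indicator B) = density \<mu> (\<lambda>_. ennreal p)"
    proof (rule measure_eqI_cylinders[OF finite_I])
      show "finite_measure (density \<mu> (indicator B))"
        by (rule finite_measureI) (use B in \<open>simp add: emeasure_restricted emeasure_eq_measure\<close>)
      show "emeasure (density \<mu> (indicator B)) (cylinder I w) = emeasure (density \<mu> (\<lambda>_. ennreal p)) (cylinder I w)" for w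
        using B cylinder_sets[of w] indep[of w] p
        by (simp add: emeasure_restricted emeasure_density_const emeasure_eq_measure Int_commute ennreal_mult)
    qed (simp_all add: sets)
    then have "emeasure (density \<mu> (indicator B)) B = emeasure (density \<mu> (\<lambda>_. ennreal p)) B"
      by simp
    then have "p = p * p"
      using B p by (simp add: emeasure_restricted emeasure_density_const emeasure_eq_measure p_def[symmetric] flip: ennreal_mult)
    then show False using p by simp
  qed
qed

end

theorem ergodic_maximiser:
  assumes K: "compactin (seq_top I) K"
  obtains \<mu> m where "m \<in> masses" "\<mu> \<in> invariant_measures I K" "shift_ergodic \<mu>"
    "\<And>w. measure \<mu> (cylinder I w) = m w" "pressure_limit = measure_entropy I \<mu> + energy_rate m"
proof -
  obtain m where max: "m \<in> maximisers" and ext: "extreme_mass m"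
    using extreme_maximiser by blast
  from max have m: "m \<in> masses" "pressure_limit = entropy_rate m + energy_rate m"
    by (auto simp: maximisers_iff)
  obtain \<mu> where \<mu>: "prob_space \<mu>" "sets \<mu> = sets (seq_borel I)"
    "\<And>w. set w \<subseteq> I \<Longrightarrow> measure \<mu> (cylinder I w) = m w"
    using cylinder_masses_extend[OF finite_I m_nonneg[OF m(1)] m_Nil[OF m(1)] m_snoc[OF m(1)]] by blast
  have cyl: "measure \<mu> (cylinder I w) = m w" for w
  proof (cases "set w \<subseteq> I")
    case False
    then have "w \<notin> lang (length w)" using lang_subset_words[of "length w"] by (auto simp: words_def)
    then show ?thesis using m_off[OF m(1)] False by (simp add: cylinder_eq_empty)
  qed (rule \<mu>(3))
  note facts = \<mu>(1,2) m(1) cyl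
  show ?thesis
  proof (rule that[OF m(1) _ _ cyl])
    show "\<mu> \<in> invariant_measures I K"
      using shift_invariant[OF facts] support_subset[OF facts K] \<mu>(1,2) by (simp add: invariant_measures_def)
    show "shift_ergodic \<mu>" by (rule extreme_masses_ergodic[OF facts ext])
    show "pressure_limit = measure_entropy I \<mu> + energy_rate m"
      using m(2) measure_entropy_eq_entropy_rate[OF facts] by simp
  qed
qed

end

lemma word_mat_append: "word_mat A (u @ v) = word_mat A u ** word_mat A v"
  by (induction u) (simp_all add: word_mat_def matrix_mul_assoc)

lemma word_mat_invertible:
  "(\<And>i. i \<in> I \<Longrightarrow> invertible (A i)) \<Longrightarrow> set w \<subseteq> I \<Longrightarrow> invertible (word_mat A w)"
proof (induction w)
  case Nil
  then show ?case unfolding word_mat_def invertible_def by (intro exI[of _ "mat 1"]) simp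
next
  case (Cons i w)
  then show ?case by (auto simp: word_mat_def intro!: invertible_mult)
qed

text \<open>Removing the first matrix by multiplying with its inverse costs at most a constant factor, by
  \<open>svf_mult_le\<close>.\<close>

lemma svf_word_lower_bound:
  fixes A :: "'i \<Rightarrow> real^'d^'d"
  assumes I: "finite I" and A: "\<And>i. i \<in> I \<Longrightarrow> invertible (A i)" and t: "t \<ge> 0"
  obtains c where "\<And>w. set w \<subseteq> I \<Longrightarrow> - c * real (length w + 1) \<le> ln (svf t (word_mat A w))"
proof -
  define C where "C = ln (2 ^ CARD('d) :: real)"
  have "\<forall>i\<in>I. \<exists>B. A i ** B = mat 1 \<and> B ** A i = mat 1"
    using A by (simp add: invertible_def)
  then obtain B where B: "\<forall>i\<in>I. A i ** B i = mat 1 \<and> B i ** A i = mat 1"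
    by (rule bchoice[THEN exE])
  define b where "b i = C + ln (svf t (B i))" for i
  define c where "c = \<bar>ln (svf t (word_mat A []))\<bar> + (\<Sum>i\<in>I. \<bar>b i\<bar>)"
  have s: "0 \<le> (\<Sum>i\<in>I. \<bar>b i\<bar>)" by (simp add: sum_nonneg)
  have "- c * real (length w + 1) \<le> ln (svf t (word_mat A w))" if "set w \<subseteq> I" for w
    using that
  proof (induction w)
    case Nil
    have "- c \<le> ln (svf t (word_mat A []))" using s unfolding c_def by linarith
    then show ?case by simp
  next
    case (Cons i w)
    define M where "M = word_mat A w"
    have i: "i \<in> I" and w: "set w \<subseteq> I" using Cons.prems by auto
    have inv: "invertible M" "invertible (A i)" "invertible (A i ** M)"
      using word_mat_invertible[OF A w] A[OF i] by (auto simp: M_def intro: invertible_mult)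
    have left: "B i ** A i = mat 1" "A i ** B i = mat 1" using B i by auto
    have inv': "invertible (B i)" using left unfolding invertible_def by blast
    have "M = B i ** (A i ** M)" by (simp add: matrix_mul_assoc left)
    then have "svf t M \<le> 2 ^ CARD('d) * (svf t (B i) * svf t (A i ** M))"
      using svf_mult_le[OF inv' inv(3) t] by simp
    then have "ln (svf t M) \<le> ln (2 ^ CARD('d) * (svf t (B i) * svf t (A i ** M)))"
      using svf_pos[OF inv(1) t] svf_pos[OF inv' t] svf_pos[OF inv(3) t] by (subst ln_le_cancel_iff) auto
    also have "\<dots> = b i + ln (svf t (A i ** M))"
      using svf_pos[OF inv' t] svf_pos[OF inv(3) t] by (simp add: b_def C_def ln_mult)
    also have "b i \<le> c"
      using member_le_sum[OF i, of "\<lambda>i. \<bar>b i\<bar>"] I unfolding c_def by simp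
    finally have "ln (svf t M) \<le> c + ln (svf t (A i ** M))" by simp
    moreover have "word_mat A (i # w) = A i ** M" by (simp add: word_mat_def M_def)
    ultimately show ?case using Cons.IH[OF w] by (simp add: M_def algebra_simps)
  qed
  then show ?thesis by (rule that)
qed

theorem theorem3p3:
  fixes I :: "'i set" and A :: "'i \<Rightarrow> real ^ 'd ^ 'd"
    and K :: "(nat \<Rightarrow> 'i) set" and t :: real
  assumes "finite I" and "card I \<ge> 2"
    and "\<And>i. i \<in> I \<Longrightarrow> invertible (A i)"
    and "K \<noteq> {}" and "compactin (seq_top I) K" and "left_shift ` K \<subseteq> K"
    and "t \<ge> 0"
  shows "\<exists>\<mu>. equilibrium_measure I A K t \<mu> \<and> shift_ergodic \<mu>"
proof -
  have inv: "invertible (word_mat A w)" if "set w \<subseteq> I" for w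
    using word_mat_invertible[of I A w] assms(3) that by blast
  obtain c where c: "\<And>w. set w \<subseteq> I \<Longrightarrow> - c * real (length w + 1) \<le> ln (svf t (word_mat A w))"
    using svf_word_lower_bound[of I A, OF assms(1,3,7)] by blast
  interpret weighted_subshift I K "\<lambda>w. svf t (word_mat A w)" "ln (2 ^ CARD('d))" c
  proof
    show "x n \<in> I" if "x \<in> K" for x n
      using compactin_subset_topspace[OF assms(5)] that by (auto simp: topspace_seq_top)
    show "0 < svf t (word_mat A w)" if "set w \<subseteq> I" for w
      by (rule svf_pos[OF inv[OF that] assms(7)])
    fix u v assume u: "set u \<subseteq> I" and v: "set v \<subseteq> I"
    have uv: "set (u @ v) \<subseteq> I" using u v by simp
    have "0 < svf t (word_mat A (u @ v))" by (rule svf_pos[OF inv[OF uv] assms(7)])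
    then have "ln (svf t (word_mat A (u @ v))) \<le> ln (2 ^ CARD('d) * (svf t (word_mat A u) * svf t (word_mat A v)))"
      using svf_mult_le[OF inv[OF u] inv[OF v] assms(7)] svf_pos[OF inv[OF u] assms(7)]
        svf_pos[OF inv[OF v] assms(7)] by (subst ln_le_cancel_iff) (auto simp: word_mat_append)
    then show "ln (svf t (word_mat A (u @ v)))
        \<le> ln (svf t (word_mat A u)) + ln (svf t (word_mat A v)) + ln (2 ^ CARD('d))"
      using svf_pos[OF inv[OF u] assms(7)] svf_pos[OF inv[OF v] assms(7)] by (simp add: ln_mult)
  qed (use assms c in auto)
  obtain \<mu> m where \<mu>: "\<mu> \<in> invariant_measures I K" "shift_ergodic \<mu>"
    "\<And>w. measure \<mu> (cylinder I w) = m w" "pressure_limit = measure_entropy I \<mu> + energy_rate m"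
    using ergodic_maximiser[OF assms(5)] by metis
  have "pressure A K t = pressure_limit"
    by (simp add: pressure_def pressure_limit_def partition_sum_def lang_def divide_inverse mult.commute)
  moreover have "energy I A t \<mu> = energy_rate m"
    by (simp add: energy_def energy_rate_def block_energy_def \<mu>(3) divide_inverse mult.commute)
  ultimately have "equilibrium_measure I A K t \<mu>" using \<mu> by (simp add: equilibrium_measure_def)
  then show ?thesis using \<mu>(2) by blast
qed

end
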